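(* If every constraint in an instance $(S,U,A,C)$ of WSP is user-independent, then the instance can be solved in time $O^*(2^{k\log k})$, where $k=|S|$.
   Context: An instance of WSP is a tuple $(S,U,A,C)$: $S$ a finite set of tasks ($k=|S|$), $U$ a finite set of users ($n=|U|$), $A(s)\subseteq U$ the authorization list of $s\in S$ (arbitrary), $C$ a set of constraints ($m=|C|$); a constraint is a pair $(L,\Theta)$ with $L\subseteq S$ and $\Theta$ a set of functions $L\to U$. A plan $\pi:T\to X$ ($T\subseteq S$, $X\subseteq U$) satisfies $(L,\Theta)$ if $L\setminus T\neq\emptyset$ or $\pi|_L\in\Theta$; it is eligible if it satisfies all constraints, authorized if $\pi(s)\in A(s)$ for all $s\in T$, valid if both, complete if it is a plan $S\to U$. Solving WSP means outputting a valid complete plan if one exists and reporting that none exists otherwise. A constraint $(L,\Theta)$ is user-independent if $\psi\circ\theta\in\Theta$ for all $\theta\in\Theta$ and all permutations $\psi$ of $U$. It is assumed each constraint and authorization can be checked in time polynomial in $n,k,m$; $O^*(h)$ means $O(q(n,k,m)h)$ for a polynomial $q$; $\log$ is base 2. *)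

theory Defs
  imports Complex_Main "HOL-Library.Log_Nat" "HOL-Combinatorics.Permutations"
begin

section \<open>The workflow satisfiability problem\<close>

text \<open>A plan \<open>T \<rightarrow> X\<close> is a partial map with domain \<open>T\<close>; a constraint \<open>(L, \<Theta>)\<close> has as
  \<open>\<Theta>\<close> a set of maps with domain exactly \<open>L\<close>.\<close>

type_synonym ('s, 'u) plan = "'s \<rightharpoonup> 'u"
type_synonym ('s, 'u) wsp_constraint = "'s set \<times> ('s, 'u) plan set"

record ('s, 'u) wsp =
  Tasks :: "'s set"
  Users :: "'u set"
  Auth :: "'s \<Rightarrow> 'u set"
  Constraints :: "('s, 'u) wsp_constraint set"

definition wsp_instance :: "('s, 'u) wsp \<Rightarrow> bool" where
  "wsp_instance W \<longleftrightarrow>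
     finite (Tasks W) \<and> finite (Users W) \<and> finite (Constraints W) \<and>
     (\<forall>s\<in>Tasks W. Auth W s \<subseteq> Users W) \<and>
     (\<forall>(L, \<Theta>)\<in>Constraints W. L \<subseteq> Tasks W \<and> (\<forall>\<theta>\<in>\<Theta>. dom \<theta> = L \<and> ran \<theta> \<subseteq> Users W))"

definition is_plan :: "('s, 'u) wsp \<Rightarrow> ('s, 'u) plan \<Rightarrow> bool" where
  "is_plan W \<pi> \<longleftrightarrow> dom \<pi> \<subseteq> Tasks W \<and> ran \<pi> \<subseteq> Users W"

fun satisfies :: "('s, 'u) plan \<Rightarrow> ('s, 'u) wsp_constraint \<Rightarrow> bool" where
  "satisfies \<pi> (L, \<Theta>) \<longleftrightarrow> L - dom \<pi> \<noteq> {} \<or> \<pi> |` L \<in> \<Theta>"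

definition eligible_plan :: "('s, 'u) wsp \<Rightarrow> ('s, 'u) plan \<Rightarrow> bool" where
  "eligible_plan W \<pi> \<longleftrightarrow> (\<forall>c\<in>Constraints W. satisfies \<pi> c)"

definition authorized_plan :: "('s, 'u) wsp \<Rightarrow> ('s, 'u) plan \<Rightarrow> bool" where
  "authorized_plan W \<pi> \<longleftrightarrow> (\<forall>s\<in>dom \<pi>. the (\<pi> s) \<in> Auth W s)"

definition valid_plan :: "('s, 'u) wsp \<Rightarrow> ('s, 'u) plan \<Rightarrow> bool" where
  "valid_plan W \<pi> \<longleftrightarrow> eligible_plan W \<pi> \<and> authorized_plan W \<pi>"

definition complete_plan :: "('s, 'u) wsp \<Rightarrow> ('s, 'u) plan \<Rightarrow> bool" where
  "complete_plan W \<pi> \<longleftrightarrow> is_plan W \<pi> \<and> dom \<pi> = Tasks W"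

fun user_independent :: "'u set \<Rightarrow> ('s, 'u) wsp_constraint \<Rightarrow> bool" where
  "user_independent U (L, \<Theta>) \<longleftrightarrow>
     (\<forall>\<theta>\<in>\<Theta>. \<forall>\<psi>. \<psi> permutes U \<longrightarrow> map_option \<psi> \<circ> \<theta> \<in> \<Theta>)"


section \<open>Programs and their running time\<close>

text \<open>Structured programs for a random access machine over the natural numbers, with addition
  and truncated subtraction, charged by the logarithmic cost criterion: every intermediate value
  costs its bit length. Memory consists of named arrays of unbounded length; a scalar variable is
  cell 0 of an array. \<open>AuthQ\<close> and \<open>ConQ\<close> invoke the authorization and the constraint
  check and store the answer, 0 or 1, in a scalar.\<close>

type_synonym vname = string
type_synonym state = "vname \<Rightarrow> nat \<Rightarrow> nat"

datatype aexp = N nat | Rd vname aexp | Plus aexp aexp | Minus aexp aexp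

datatype bexp = Less aexp aexp | Eq aexp aexp | Neg bexp | Conj bexp bexp

datatype com =
    Skip
  | Write vname aexp aexp
  | Seq com com
  | If bexp com com
  | While bexp com
  | AuthQ vname aexp aexp
  | ConQ vname aexp vname

fun aval :: "aexp \<Rightarrow> state \<Rightarrow> nat" where
  "aval (N c) \<sigma> = c"
| "aval (Rd x e) \<sigma> = \<sigma> x (aval e \<sigma>)"
| "aval (Plus e f) \<sigma> = aval e \<sigma> + aval f \<sigma>"
| "aval (Minus e f) \<sigma> = aval e \<sigma> - aval f \<sigma>"

fun bval :: "bexp \<Rightarrow> state \<Rightarrow> bool" where
  "bval (Less e f) \<sigma> \<longleftrightarrow> aval e \<sigma> < aval f \<sigma>"
| "bval (Eq e f) \<sigma> \<longleftrightarrow> aval e \<sigma> = aval f \<sigma>"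
| "bval (Neg b) \<sigma> \<longleftrightarrow> \<not> bval b \<sigma>"
| "bval (Conj b c) \<sigma> \<longleftrightarrow> bval b \<sigma> \<and> bval c \<sigma>"

text \<open>\<open>floorlog 2 v\<close> is the bit length of \<open>v\<close>.\<close>

fun acost :: "aexp \<Rightarrow> state \<Rightarrow> nat" where
  "acost (N c) \<sigma> = 1 + floorlog 2 c"
| "acost (Rd x e) \<sigma> = acost e \<sigma> + 1 + floorlog 2 (aval (Rd x e) \<sigma>)"
| "acost (Plus e f) \<sigma> = acost e \<sigma> + acost f \<sigma> + 1 + floorlog 2 (aval (Plus e f) \<sigma>)"
| "acost (Minus e f) \<sigma> = acost e \<sigma> + acost f \<sigma> + 1 + floorlog 2 (aval (Minus e f) \<sigma>)"

fun bcost :: "bexp \<Rightarrow> state \<Rightarrow> nat" where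
  "bcost (Less e f) \<sigma> = acost e \<sigma> + acost f \<sigma> + 1"
| "bcost (Eq e f) \<sigma> = acost e \<sigma> + acost f \<sigma> + 1"
| "bcost (Neg b) \<sigma> = bcost b \<sigma> + 1"
| "bcost (Conj b c) \<sigma> = bcost b \<sigma> + bcost c \<sigma> + 1"

definition upd :: "vname \<Rightarrow> nat \<Rightarrow> nat \<Rightarrow> state \<Rightarrow> state" where
  "upd x i v \<sigma> = \<sigma>(x := (\<sigma> x)(i := v))"

text \<open>\<open>exec oa oc P \<sigma> t \<tau>\<close>: started in \<open>\<sigma>\<close>, the program \<open>P\<close> halts in \<open>\<tau>\<close> after time \<open>t\<close>.
  The checks \<open>oa\<close> and \<open>oc\<close> return an answer together with the time taken to compute it; an
  ill-formed query (\<open>None\<close>) gets the program stuck.\<close>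

inductive exec ::
    "(nat \<Rightarrow> nat \<Rightarrow> (bool \<times> nat) option) \<Rightarrow> (nat \<Rightarrow> (nat \<Rightarrow> nat) \<Rightarrow> (bool \<times> nat) option) \<Rightarrow>
     com \<Rightarrow> state \<Rightarrow> nat \<Rightarrow> state \<Rightarrow> bool"
  for oa oc where
  Skip: "exec oa oc Skip \<sigma> 1 \<sigma>"
| Write: "exec oa oc (Write x i e) \<sigma> (1 + acost i \<sigma> + acost e \<sigma>) (upd x (aval i \<sigma>) (aval e \<sigma>) \<sigma>)"
| Seq: "exec oa oc P \<sigma> t \<sigma>' \<Longrightarrow> exec oa oc Q \<sigma>' t' \<tau> \<Longrightarrow> exec oa oc (Seq P Q) \<sigma> (t + t') \<tau>"
| IfTrue: "bval b \<sigma> \<Longrightarrow> exec oa oc P \<sigma> t \<tau> \<Longrightarrow> exec oa oc (If b P Q) \<sigma> (1 + bcost b \<sigma> + t) \<tau>"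
| IfFalse: "\<not> bval b \<sigma> \<Longrightarrow> exec oa oc Q \<sigma> t \<tau> \<Longrightarrow> exec oa oc (If b P Q) \<sigma> (1 + bcost b \<sigma> + t) \<tau>"
| WhileFalse: "\<not> bval b \<sigma> \<Longrightarrow> exec oa oc (While b P) \<sigma> (1 + bcost b \<sigma>) \<sigma>"
| WhileTrue: "bval b \<sigma> \<Longrightarrow> exec oa oc P \<sigma> t \<sigma>' \<Longrightarrow> exec oa oc (While b P) \<sigma>' t' \<tau> \<Longrightarrow>
    exec oa oc (While b P) \<sigma> (1 + bcost b \<sigma> + t + t') \<tau>"
| AuthQ: "oa (aval e \<sigma>) (aval f \<sigma>) = Some (r, t) \<Longrightarrow>
    exec oa oc (AuthQ x e f) \<sigma> (1 + acost e \<sigma> + acost f \<sigma> + t) (upd x 0 (of_bool r) \<sigma>)"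
| ConQ: "oc (aval e \<sigma>) (\<sigma> y) = Some (r, t) \<Longrightarrow>
    exec oa oc (ConQ x e y) \<sigma> (1 + acost e \<sigma> + t) (upd x 0 (of_bool r) \<sigma>)"

inductive_cases exec_SkipE: "exec oa oc Skip \<sigma> t \<tau>"
inductive_cases exec_WriteE: "exec oa oc (Write x i e) \<sigma> t \<tau>"
inductive_cases exec_SeqE: "exec oa oc (Seq P Q) \<sigma> t \<tau>"
inductive_cases exec_IfE: "exec oa oc (If b P Q) \<sigma> t \<tau>"
inductive_cases exec_WhileE: "exec oa oc (While b P) \<sigma> t \<tau>"
inductive_cases exec_AuthQE: "exec oa oc (AuthQ x e f) \<sigma> t \<tau>"
inductive_cases exec_ConQE: "exec oa oc (ConQ x e y) \<sigma> t \<tau>"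

lemma exec_deterministic:
  "exec oa oc P \<sigma> t \<tau> \<Longrightarrow> exec oa oc P \<sigma> t' \<tau>' \<Longrightarrow> t' = t \<and> \<tau>' = \<tau>"
proof (induction arbitrary: t' \<tau>' rule: exec.induct)
  case Skip
  then show ?case by (auto elim: exec_SkipE)
next
  case Write
  then show ?case by (auto elim: exec_WriteE)
next
  case (Seq P \<sigma> t \<sigma>' Q u \<tau>)
  from Seq.prems show ?case
    by (rule exec_SeqE) (use Seq.IH in metis)
next
  case (IfTrue b \<sigma> P t \<tau> Q)
  from IfTrue.prems show ?case
    by (rule exec_IfE) (use IfTrue.hyps in \<open>auto dest: IfTrue.IH\<close>)
next
  case (IfFalse b \<sigma> Q t \<tau> P)
  from IfFalse.prems show ?case
    by (rule exec_IfE) (use IfFalse.hyps in \<open>auto dest: IfFalse.IH\<close>)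
next
  case (WhileFalse b \<sigma> P)
  from WhileFalse.prems show ?case
    by (rule exec_WhileE) (use WhileFalse.hyps in auto)
next
  case (WhileTrue b \<sigma> P t \<sigma>' u \<tau>)
  from WhileTrue.prems show ?case
    by (rule exec_WhileE) (use WhileTrue.hyps in \<open>auto dest!: WhileTrue.IH\<close>)
next
  case AuthQ
  then show ?case by (auto elim!: exec_AuthQE)
next
  case ConQ
  then show ?case by (auto elim!: exec_ConQE)
qed


section \<open>Solving an instance\<close>

text \<open>A program refers to tasks, users and constraints by their positions in duplicate-free
  lists \<open>ss\<close>, \<open>us\<close>, \<open>cs\<close>. An array represents a plan by the positions of the users;
  an entry that is not the position of a user means that the task is unassigned.\<close>

definition enumerates :: "('s, 'u) wsp \<Rightarrow> 's list \<Rightarrow> 'u list \<Rightarrow> ('s, 'u) wsp_constraint list \<Rightarrow> bool" where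
  "enumerates W ss us cs \<longleftrightarrow>
     distinct ss \<and> set ss = Tasks W \<and> distinct us \<and> set us = Users W \<and>
     distinct cs \<and> set cs = Constraints W"

definition decode :: "'s list \<Rightarrow> 'u list \<Rightarrow> (nat \<Rightarrow> nat) \<Rightarrow> ('s, 'u) plan" where
  "decode ss us a =
     map_of (map (\<lambda>i. (ss ! i, us ! a i)) (filter (\<lambda>i. a i < length us) [0..<length ss]))"

definition auth_check ::
    "('s, 'u) wsp \<Rightarrow> ('s \<Rightarrow> 'u \<Rightarrow> nat) \<Rightarrow> 's list \<Rightarrow> 'u list \<Rightarrow>
     nat \<Rightarrow> nat \<Rightarrow> (bool \<times> nat) option" where
  "auth_check W ta ss us i j =
     (if i < length ss \<and> j < length us
      then Some (us ! j \<in> Auth W (ss ! i), ta (ss ! i) (us ! j)) else None)"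

definition con_check ::
    "(('s, 'u) wsp_constraint \<Rightarrow> ('s, 'u) plan \<Rightarrow> nat) \<Rightarrow>
     's list \<Rightarrow> 'u list \<Rightarrow> ('s, 'u) wsp_constraint list \<Rightarrow>
     nat \<Rightarrow> (nat \<Rightarrow> nat) \<Rightarrow> (bool \<times> nat) option" where
  "con_check tc ss us cs c a =
     (if c < length cs
      then Some (satisfies (decode ss us a) (cs ! c), tc (cs ! c) (decode ss us a)) else None)"

definition initial :: "nat \<Rightarrow> nat \<Rightarrow> nat \<Rightarrow> state" where
  "initial n k m = upd ''n'' 0 n (upd ''k'' 0 k (upd ''m'' 0 m (\<lambda>_ _. 0)))"

definition solution :: "('s, 'u) wsp \<Rightarrow> 's list \<Rightarrow> 'u list \<Rightarrow> state \<Rightarrow> bool" where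
  "solution W ss us \<tau> \<longleftrightarrow>
     (if \<exists>\<pi>. complete_plan W \<pi> \<and> valid_plan W \<pi>
      then \<tau> ''found'' 0 = 1 \<and>
           complete_plan W (decode ss us (\<tau> ''plan'')) \<and> valid_plan W (decode ss us (\<tau> ''plan''))
      else \<tau> ''found'' 0 = 0)"

definition polynomial3 :: "(nat \<Rightarrow> nat \<Rightarrow> nat \<Rightarrow> real) \<Rightarrow> bool" where
  "polynomial3 q \<longleftrightarrow> (\<exists>(d::nat) (c :: nat \<Rightarrow> nat \<Rightarrow> nat \<Rightarrow> real). \<forall>n k m.
     q n k m = (\<Sum>i\<le>d. \<Sum>j\<le>d. \<Sum>l\<le>d. c i j l * real n ^ i * real k ^ j * real m ^ l))"

text \<open>\<open>ta s u\<close> is the time to check whether \<open>u\<close> is authorized for \<open>s\<close>, and \<open>tc c \<pi>\<close> the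
  time to check whether \<open>\<pi>\<close> satisfies \<open>c\<close>.\<close>

definition checks_within ::
    "(nat \<Rightarrow> nat \<Rightarrow> nat \<Rightarrow> real) \<Rightarrow> ('s, 'u) wsp \<Rightarrow>
     ('s \<Rightarrow> 'u \<Rightarrow> nat) \<Rightarrow> (('s, 'u) wsp_constraint \<Rightarrow> ('s, 'u) plan \<Rightarrow> nat) \<Rightarrow> bool" where
  "checks_within p W ta tc \<longleftrightarrow>
     (let B = p (card (Users W)) (card (Tasks W)) (card (Constraints W)) in
      (\<forall>s\<in>Tasks W. \<forall>u\<in>Users W. real (ta s u) \<le> B) \<and>
      (\<forall>c\<in>Constraints W. \<forall>\<pi>. is_plan W \<pi> \<longrightarrow> real (tc c \<pi>) \<le> B))"

text \<open>\<open>P\<close> solves every instance satisfying \<open>\<Phi>\<close>, however its items are listed, in time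
  \<open>O\<^sup>*(h k)\<close>, provided that checks take time at most \<open>p n k m\<close>.\<close>

definition solves_in_O_star ::
    "(nat \<Rightarrow> nat \<Rightarrow> nat \<Rightarrow> real) \<Rightarrow> com \<Rightarrow> (('s, 'u) wsp \<Rightarrow> bool) \<Rightarrow> (nat \<Rightarrow> real) \<Rightarrow> bool" where
  "solves_in_O_star p P \<Phi> h \<longleftrightarrow>
     (\<exists>q C. polynomial3 q \<and>
       (\<forall>W ss us cs ta tc n k m.
          wsp_instance W \<and> \<Phi> W \<and> enumerates W ss us cs \<and> checks_within p W ta tc \<and>
          n = card (Users W) \<and> k = card (Tasks W) \<and> m = card (Constraints W) \<longrightarrow>
          (\<exists>t \<tau>. exec (auth_check W ta ss us) (con_check tc ss us cs) P (initial n k m) t \<tau> \<and>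
                 solution W ss us \<tau> \<and>
                 real t \<le> C * (q n k m * h k))))"

end

theory Submission imports Defs begin

text \<open>Since constraints are user-independent, whether a complete plan is eligible depends only on
  its kernel, the partition of the tasks into blocks performed by the same user. Every kernel is
  the kernel of one of the \<open>k ^ k\<close> functions \<open>f\<close> from tasks to \<open>{0..<k}\<close>. For each \<open>f\<close>, an
  authorized plan with the kernel of \<open>f\<close> is a matching of the blocks into the users, which an
  auction with prices at most \<open>k\<close> finds, or refutes by Hall's condition, in polynomial time;
  one test of all constraints then decides whether \<open>f\<close> is the kernel of a valid plan.\<close>

section \<open>Reasoning about programs\<close>

text \<open>The \<open>n ^ k\<close> plans are too many to try, whereas \<open>k ^ k\<close> equals
  \<open>2 powr (k * log 2 k)\<close>. One constraint test per kernel suffices because two complete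
  plans with the same kernel differ by an injection between the users they employ; it extends to a
  permutation of the finite user set, and user-independence transports satisfaction along it. Within
  one kernel only authorization distinguishes plans, and that is bipartite matching of blocks and
  users. Functions stand in for partitions because a base-\<open>k\<close> counter enumerates them,
  with the number of patterns left as termination measure. The auction stands in for augmenting
  paths: a round is a few plain scans over tasks and users, its correctness is a loop invariant, and
  each round but the last raises a price that is below \<open>k\<close>, which leaves at most
  \<open>n * k\<close> raises. The obstacle is the running time of a concrete program under
  logarithmic cost. Every memory cell stays at most \<open>n + k + m + 2\<close>, so an elementary
  step has polynomial cost, and the time of everything inside the outermost loop can be read off the
  syntax. Only the outermost loop needs an iteration count of its own.\<close>

lemma upd_same [simp]: "upd x i v \<sigma> x = (\<sigma> x)(i := v)"
  by (simp add: upd_def)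

lemma upd_other [simp]: "y \<noteq> x \<Longrightarrow> upd x i v \<sigma> y = \<sigma> y"
  by (simp add: upd_def)

fun writes :: "com \<Rightarrow> vname set" where
  "writes Skip = {}"
| "writes (Write x i e) = {x}"
| "writes (Seq c d) = writes c \<union> writes d"
| "writes (If b c d) = writes c \<union> writes d"
| "writes (While b c) = writes c"
| "writes (AuthQ x e f) = {x}"
| "writes (ConQ x e y) = {x}"

lemma exec_frame: "exec oa oc c \<sigma> t \<tau> \<Longrightarrow> z \<notin> writes c \<Longrightarrow> \<tau> z = \<sigma> z"
  by (induction rule: exec.induct) auto

text \<open>A literal counts with its value, so that \<open>asize e * S\<close> bounds the value of
  \<open>e\<close> for constants as well.\<close>

fun asize :: "aexp \<Rightarrow> nat" where
  "asize (N c) = c + 1"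
| "asize (Rd x e) = asize e + 1"
| "asize (Plus e f) = asize e + asize f + 1"
| "asize (Minus e f) = asize e + asize f + 1"

fun bsize :: "bexp \<Rightarrow> nat" where
  "bsize (Less e f) = asize e + asize f + 1"
| "bsize (Eq e f) = asize e + asize f + 1"
| "bsize (Neg b) = bsize b + 1"
| "bsize (Conj b c) = bsize b + bsize c + 1"

definition bounded_by :: "nat \<Rightarrow> state \<Rightarrow> bool" where
  "bounded_by S \<sigma> \<longleftrightarrow> (\<forall>x i. \<sigma> x i \<le> S)"

lemma bounded_by_upd: "bounded_by S \<sigma> \<Longrightarrow> v \<le> S \<Longrightarrow> bounded_by S (upd x i v \<sigma>)"
  by (auto simp: bounded_by_def upd_def)

section \<open>Logarithmic cost of expressions over bounded memory\<close>

lemma floorlog_le: "floorlog 2 v \<le> v"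
proof (cases "v = 0")
  case False
  then have "2 ^ (floorlog 2 v - 1) \<le> v"
    using floorlog_bounds[of v 2] by simp
  moreover have "floorlog 2 v - 1 < 2 ^ (floorlog 2 v - 1)"
    by (rule less_exp)
  ultimately show ?thesis by linarith
qed (simp add: floorlog_def)

lemma aval_le:
  assumes "bounded_by S \<sigma>" "1 \<le> S"
  shows "aval e \<sigma> \<le> asize e * S"
proof (induction e)
  case (N c)
  have "c * 1 \<le> c * S" using assms(2) by (intro mult_le_mono) auto
  then have "c \<le> c * S" by simp
  then show ?case by (simp add: trans_le_add2)
next
  case (Rd x e)
  have "\<sigma> x (aval e \<sigma>) \<le> S" using assms(1) by (simp add: bounded_by_def)
  then show ?case by simp
qed (auto simp: algebra_simps)

text \<open>Each of the at most \<open>asize e\<close> nodes is charged 1 plus the bit length of its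
  value, hence at most \<open>1 + L * S\<close>. The separate \<open>L\<close> bounds all
  subexpressions at once and stays fixed during the induction.\<close>

lemma acost_le:
  assumes "bounded_by S \<sigma>" "1 \<le> S" "asize e \<le> L"
  shows "acost e \<sigma> \<le> asize e * (1 + L * S)"
proof -
  have *: "floorlog 2 (aval e \<sigma>) \<le> L * S" if "asize e \<le> L" for e
  proof -
    have "floorlog 2 (aval e \<sigma>) \<le> asize e * S"
      using floorlog_le aval_le[OF assms(1,2)] le_trans by blast
    also have "\<dots> \<le> L * S" using that by simp
    finally show ?thesis .
  qed
  show ?thesis using assms(3)
  proof (induction e)
    case (N c)
    with *[of "N c"] show ?case by (simp add: algebra_simps)
  next
    case (Rd x e)
    with *[of "Rd x e"] show ?case by (simp add: algebra_simps)
  next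
    case (Plus e f)
    with *[of "Plus e f"] show ?case by (simp add: algebra_simps)
  next
    case (Minus e f)
    with *[of "Minus e f"] show ?case by (simp add: algebra_simps)
  qed
qed

lemma bcost_le:
  assumes "bounded_by S \<sigma>" "1 \<le> S" "bsize b \<le> L"
  shows "bcost b \<sigma> \<le> bsize b * (1 + L * S)"
  using assms(3)
proof (induction b)
  case (Less e f)
  then show ?case
    using acost_le[OF assms(1,2), of e L] acost_le[OF assms(1,2), of f L] by (simp add: algebra_simps)
next
  case (Eq e f)
  then show ?case
    using acost_le[OF assms(1,2), of e L] acost_le[OF assms(1,2), of f L] by (simp add: algebra_simps)
qed (auto simp: algebra_simps)

text \<open>Every loop except the outermost one makes at most \<open>S\<^sup>2\<close> iterations, where \<open>S\<close> exceeds the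
  input size; \<open>cost\<close> and \<open>depth\<close> are the coefficient and the exponent of \<open>S\<close> in the resulting
  time bound.\<close>

fun cost :: "com \<Rightarrow> nat" where
  "cost (Seq c d) = cost c + cost d"
| "cost (If b c d) = 1 + cost c + cost d"
| "cost (While b c) = 2 + cost c"
| "cost _ = 1"

fun depth :: "com \<Rightarrow> nat" where
  "depth (Seq c d) = max (depth c) (depth d)"
| "depth (If b c d) = max (depth c) (depth d)"
| "depth (While b c) = depth c + 2"
| "depth _ = 0"

abbreviation var :: "vname \<Rightarrow> aexp" where
  "var x \<equiv> Rd x (N 0)"

abbreviation assign :: "vname \<Rightarrow> aexp \<Rightarrow> com" where
  "assign x e \<equiv> Write x (N 0) e"

definition For :: "vname \<Rightarrow> vname \<Rightarrow> com \<Rightarrow> com" where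
  "For x y c = Seq (assign x (N 0))
     (While (Less (var x) (var y)) (Seq c (assign x (Plus (var x) (N 1)))))"

lemma writes_For [simp]: "writes (For x y c) = insert x (writes c)"
  by (auto simp: For_def)

text \<open>Tasks, users and constraints survive only as indices. User-independence survives only as
  \<open>con_kernel\<close>, which compares total assignments with the same equality pattern;
  \<open>R\<close> bounds the time of a single check.\<close>

locale wsp_machine =
  fixes oa :: "nat \<Rightarrow> nat \<Rightarrow> (bool \<times> nat) option"
    and oc :: "nat \<Rightarrow> (nat \<Rightarrow> nat) \<Rightarrow> (bool \<times> nat) option"
    and n k m R :: nat
    and auth :: "nat \<Rightarrow> nat \<Rightarrow> bool"
    and con :: "nat \<Rightarrow> (nat \<Rightarrow> nat) \<Rightarrow> bool"
  assumes auth_query: "i < k \<Longrightarrow> u < n \<Longrightarrow> \<exists>t\<le>R. oa i u = Some (auth i u, t)"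
    and con_query: "c < m \<Longrightarrow> \<exists>t\<le>R. oc c a = Some (con c a, t)"
    and con_kernel: "c < m \<Longrightarrow> \<forall>i<k. a i < n \<and> a' i < n \<Longrightarrow>
      \<forall>i<k. \<forall>j<k. a i = a j \<longleftrightarrow> a' i = a' j \<Longrightarrow> con c a \<Longrightarrow> con c a'"
begin

text \<open>The summand 2 leaves room for the constants that the programs store, the largest being
  the status code 2 in \<open>''st''\<close>.\<close>

definition S :: nat where "S = n + k + m + 2"

text \<open>An upper bound on the time of any elementary step of the programs below.\<close>

definition K :: nat where "K = R + 1000 * S"

text \<open>Total correctness in weakest-precondition style. The time bound depends on the syntax of
  \<open>c\<close> alone, so postconditions never mention time; boundedness of the memory is
  threaded through the definition and need not be restated in them.\<close>

definition runs :: "com \<Rightarrow> state \<Rightarrow> (state \<Rightarrow> bool) \<Rightarrow> bool" where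
  "runs c \<sigma> Q \<longleftrightarrow> (bounded_by S \<sigma> \<longrightarrow>
     (\<exists>t \<tau>. exec oa oc c \<sigma> t \<tau> \<and> t \<le> cost c * S ^ depth c * K \<and> bounded_by S \<tau> \<and> Q \<tau>))"

lemma S_pos: "1 \<le> S" and S_ge: "n \<le> S" "k \<le> S" "m \<le> S" "2 \<le> S"
  by (simp_all add: S_def)

lemma S_power_mono: "d \<le> e \<Longrightarrow> a * S ^ d * K \<le> a * S ^ e * K"
  using S_pos by (simp add: power_increasing)

text \<open>All expressions of the solver respect the size limits 10 (arithmetic) and 20 (Boolean).
  Two arithmetic evaluations, or one test, then fit into the \<open>1000 * S\<close> of
  \<open>K\<close>.\<close>

lemma acost_le_S: "bounded_by S \<sigma> \<Longrightarrow> asize e \<le> 10 \<Longrightarrow> acost e \<sigma> \<le> 110 * S"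
proof -
  assume a: "bounded_by S \<sigma>" "asize e \<le> 10"
  then have "acost e \<sigma> \<le> asize e * (1 + 10 * S)" using acost_le[of S \<sigma>] S_pos by blast
  also have "\<dots> \<le> 10 * (1 + 10 * S)" using a(2) by (intro mult_le_mono1)
  also have "\<dots> \<le> 110 * S" using S_pos by simp
  finally show ?thesis .
qed

lemma bcost_le_K: "bounded_by S \<sigma> \<Longrightarrow> bsize b \<le> 20 \<Longrightarrow> 1 + bcost b \<sigma> \<le> K"
proof -
  assume a: "bounded_by S \<sigma>" "bsize b \<le> 20"
  then have "bcost b \<sigma> \<le> bsize b * (1 + 20 * S)" using bcost_le[of S \<sigma>] S_pos by blast
  also have "\<dots> \<le> 20 * (1 + 20 * S)" using a(2) by (intro mult_le_mono1)
  also have "\<dots> \<le> 420 * S" using S_pos by simp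
  finally show ?thesis using S_pos by (simp add: K_def)
qed

text \<open>Boundedness and the frame condition come for free in the new postcondition, so that
  specifications and invariants describe only what a program changes.\<close>

lemma runs_conseq:
  assumes "runs c \<sigma> Q"
    and "\<And>\<tau>. bounded_by S \<tau> \<Longrightarrow> \<forall>z. z \<notin> writes c \<longrightarrow> \<tau> z = \<sigma> z \<Longrightarrow> Q \<tau> \<Longrightarrow> Q' \<tau>"
  shows "runs c \<sigma> Q'"
  unfolding runs_def
proof
  assume "bounded_by S \<sigma>"
  then obtain t \<tau> where "exec oa oc c \<sigma> t \<tau>" "t \<le> cost c * S ^ depth c * K" "bounded_by S \<tau>" "Q \<tau>"
    using assms(1) unfolding runs_def by blast
  then show "\<exists>t \<tau>. exec oa oc c \<sigma> t \<tau> \<and> t \<le> cost c * S ^ depth c * K \<and> bounded_by S \<tau> \<and> Q' \<tau>"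
    using assms(2)[of \<tau>] exec_frame[of oa oc c \<sigma> t \<tau>] by blast
qed

lemma runs_Skip: "Q \<sigma> \<Longrightarrow> runs Skip \<sigma> Q"
  unfolding runs_def using S_pos by (auto intro!: exI exec.Skip simp: K_def)

lemma runs_Write:
  assumes "asize i \<le> 10" "asize e \<le> 10" "bounded_by S \<sigma> \<Longrightarrow> aval e \<sigma> \<le> S"
    "bounded_by S \<sigma> \<Longrightarrow> Q (upd x (aval i \<sigma>) (aval e \<sigma>) \<sigma>)"
  shows "runs (Write x i e) \<sigma> Q"
  unfolding runs_def
proof
  assume b: "bounded_by S \<sigma>"
  have "1 + acost i \<sigma> + acost e \<sigma> \<le> K"
    using acost_le_S[OF b assms(1)] acost_le_S[OF b assms(2)] S_pos by (simp add: K_def)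
  then show "\<exists>t \<tau>. exec oa oc (Write x i e) \<sigma> t \<tau> \<and>
      t \<le> cost (Write x i e) * S ^ depth (Write x i e) * K \<and> bounded_by S \<tau> \<and> Q \<tau>"
    using exec.Write[of oa oc x i e \<sigma>] b assms(3,4)
    by (intro exI conjI) (auto intro!: bounded_by_upd)
qed

lemma runs_AuthQ:
  assumes "asize e \<le> 10" "asize f \<le> 10" "aval e \<sigma> < k" "aval f \<sigma> < n"
    "Q (upd x 0 (of_bool (auth (aval e \<sigma>) (aval f \<sigma>))) \<sigma>)"
  shows "runs (AuthQ x e f) \<sigma> Q"
  unfolding runs_def
proof
  assume b: "bounded_by S \<sigma>"
  obtain t where t: "t \<le> R" "oa (aval e \<sigma>) (aval f \<sigma>) = Some (auth (aval e \<sigma>) (aval f \<sigma>), t)"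
    using auth_query assms(3,4) by blast
  have "1 + acost e \<sigma> + acost f \<sigma> + t \<le> K"
    using acost_le_S[OF b assms(1)] acost_le_S[OF b assms(2)] S_pos t(1) by (simp add: K_def)
  then show "\<exists>t \<tau>. exec oa oc (AuthQ x e f) \<sigma> t \<tau> \<and>
      t \<le> cost (AuthQ x e f) * S ^ depth (AuthQ x e f) * K \<and> bounded_by S \<tau> \<and> Q \<tau>"
    using exec.AuthQ[of oa e \<sigma> f _ t oc x, OF t(2)] b assms(5) S_pos
    by (intro exI conjI) (auto intro!: bounded_by_upd)
qed

lemma runs_ConQ:
  assumes "asize e \<le> 10" "aval e \<sigma> < m"
    "Q (upd x 0 (of_bool (con (aval e \<sigma>) (\<sigma> y))) \<sigma>)"
  shows "runs (ConQ x e y) \<sigma> Q"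
  unfolding runs_def
proof
  assume b: "bounded_by S \<sigma>"
  obtain t where t: "t \<le> R" "oc (aval e \<sigma>) (\<sigma> y) = Some (con (aval e \<sigma>) (\<sigma> y), t)"
    using con_query assms(2) by blast
  have "1 + acost e \<sigma> + t \<le> K"
    using acost_le_S[OF b assms(1)] S_pos t(1) by (simp add: K_def)
  then show "\<exists>t \<tau>. exec oa oc (ConQ x e y) \<sigma> t \<tau> \<and>
      t \<le> cost (ConQ x e y) * S ^ depth (ConQ x e y) * K \<and> bounded_by S \<tau> \<and> Q \<tau>"
    using exec.ConQ[of oc e \<sigma> y _ t oa x, OF t(2)] b assms(3) S_pos
    by (intro exI conjI) (auto intro!: bounded_by_upd)
qed

lemma runs_Seq:
  assumes "runs c \<sigma> (\<lambda>\<tau>. runs d \<tau> Q)"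
  shows "runs (Seq c d) \<sigma> Q"
  unfolding runs_def
proof
  assume b: "bounded_by S \<sigma>"
  then obtain t \<tau> where 1: "exec oa oc c \<sigma> t \<tau>" "t \<le> cost c * S ^ depth c * K"
      "bounded_by S \<tau>" "runs d \<tau> Q"
    using assms unfolding runs_def by blast
  then obtain t' \<rho> where 2: "exec oa oc d \<tau> t' \<rho>" "t' \<le> cost d * S ^ depth d * K"
      "bounded_by S \<rho>" "Q \<rho>"
    unfolding runs_def by blast
  have "t + t' \<le> cost c * S ^ max (depth c) (depth d) * K + cost d * S ^ max (depth c) (depth d) * K"
    using 1(2) 2(2) S_power_mono[of "depth c" "max (depth c) (depth d)" "cost c"]
      S_power_mono[of "depth d" "max (depth c) (depth d)" "cost d"] by linarith
  then show "\<exists>t \<tau>. exec oa oc (Seq c d) \<sigma> t \<tau> \<and>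
      t \<le> cost (Seq c d) * S ^ depth (Seq c d) * K \<and> bounded_by S \<tau> \<and> Q \<tau>"
    using exec.Seq[OF 1(1) 2(1)] 2(3,4) by (intro exI conjI) (auto simp: algebra_simps)
qed

lemma runs_If:
  assumes "bsize b \<le> 20" "bval b \<sigma> \<Longrightarrow> runs c \<sigma> Q" "\<not> bval b \<sigma> \<Longrightarrow> runs d \<sigma> Q"
  shows "runs (If b c d) \<sigma> Q"
  unfolding runs_def
proof
  assume bd: "bounded_by S \<sigma>"
  let ?e = "max (depth c) (depth d)"
  have b: "1 + bcost b \<sigma> \<le> K" by (rule bcost_le_K[OF bd assms(1)])
  have "K * 1 \<le> K * S ^ ?e" using S_pos by (intro mult_le_mono) auto
  with b have b: "1 + bcost b \<sigma> \<le> S ^ ?e * K" by (metis le_trans mult.commute mult_1)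
  have m: "cost c * S ^ depth c * K \<le> cost c * S ^ ?e * K"
    "cost d * S ^ depth d * K \<le> cost d * S ^ ?e * K"
    by (rule S_power_mono, simp)+
  have eq: "(1 + cost c + cost d) * S ^ ?e * K = S ^ ?e * K + cost c * S ^ ?e * K + cost d * S ^ ?e * K"
    by (simp add: algebra_simps)
  show "\<exists>t \<tau>. exec oa oc (If b c d) \<sigma> t \<tau> \<and>
      t \<le> cost (If b c d) * S ^ depth (If b c d) * K \<and> bounded_by S \<tau> \<and> Q \<tau>"
  proof (cases "bval b \<sigma>")
    case True
    then obtain t \<tau> where 1: "exec oa oc c \<sigma> t \<tau>" "t \<le> cost c * S ^ depth c * K"
        "bounded_by S \<tau>" "Q \<tau>"
      using assms(2) bd unfolding runs_def by blast
    then have "1 + bcost b \<sigma> + t \<le> (1 + cost c + cost d) * S ^ ?e * K"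
      unfolding eq using b m by linarith
    then show ?thesis using 1 exec.IfTrue[OF True 1(1)] by auto
  next
    case False
    then obtain t \<tau> where 1: "exec oa oc d \<sigma> t \<tau>" "t \<le> cost d * S ^ depth d * K"
        "bounded_by S \<tau>" "Q \<tau>"
      using assms(3) bd unfolding runs_def by blast
    then have "1 + bcost b \<sigma> + t \<le> (1 + cost c + cost d) * S ^ ?e * K"
      unfolding eq using b m by linarith
    then show ?thesis using 1 exec.IfFalse[OF False 1(1)] by auto
  qed
qed

text \<open>The iteration count \<open>M\<close> is left open: the outermost loop, with up to
  \<open>k ^ k\<close> rounds, does not fit the quadratic limit of
  \<open>runs_While\<close>.\<close>

lemma exec_While:
  assumes "bsize b \<le> 20"
    and step: "\<And>\<sigma>. bounded_by S \<sigma> \<Longrightarrow> I \<sigma> \<Longrightarrow> bval b \<sigma> \<Longrightarrow> runs c \<sigma> (\<lambda>\<tau>. I \<tau> \<and> \<mu> \<tau> < \<mu> \<sigma>)"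
  shows "bounded_by S \<sigma> \<Longrightarrow> I \<sigma> \<Longrightarrow> \<mu> \<sigma> \<le> (M :: nat) \<Longrightarrow>
    \<exists>t \<tau>. exec oa oc (While b c) \<sigma> t \<tau> \<and> t \<le> M * (K + cost c * S ^ depth c * K) + K \<and>
      bounded_by S \<tau> \<and> I \<tau> \<and> \<not> bval b \<tau>"
proof (induction M arbitrary: \<sigma>)
  case (0 \<sigma>)
  \<comment> \<open>A true guard would make the body push \<open>\<mu>\<close> below 0.\<close>
  have "\<not> bval b \<sigma>" using step[OF 0(1,2)] 0 unfolding runs_def by auto
  from exec.WhileFalse[OF this] show ?case
    using bcost_le_K[OF 0(1) assms(1)] 0 \<open>\<not> bval b \<sigma>\<close> by (metis add.left_neutral mult_0)
next
  case (Suc M \<sigma>)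
  have b: "1 + bcost b \<sigma> \<le> K" using bcost_le_K[OF Suc.prems(1) assms(1)] .
  show ?case
  proof (cases "bval b \<sigma>")
    case False
    from exec.WhileFalse[OF False] show ?thesis
      using b Suc.prems False by (metis trans_le_add2)
  next
    case True
    from step[OF Suc.prems(1,2) True] obtain t \<tau> where
      1: "exec oa oc c \<sigma> t \<tau>" "t \<le> cost c * S ^ depth c * K" "bounded_by S \<tau>" "I \<tau>" "\<mu> \<tau> < \<mu> \<sigma>"
      using Suc.prems unfolding runs_def by blast
    have "\<mu> \<tau> \<le> M" using 1(5) Suc.prems(3) by simp
    from Suc.IH[OF 1(3,4) this] obtain t' \<rho> where
      2: "exec oa oc (While b c) \<tau> t' \<rho>" "t' \<le> M * (K + cost c * S ^ depth c * K) + K"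
        "bounded_by S \<rho>" "I \<rho>" "\<not> bval b \<rho>"
      by blast
    have "1 + bcost b \<sigma> + t + t' \<le> Suc M * (K + cost c * S ^ depth c * K) + K"
      using b 1(2) 2(2) by (simp add: algebra_simps)
    then show ?thesis using exec.WhileTrue[OF True 1(1) 2(1)] 2 by blast
  qed
qed

text \<open>The limit \<open>S ^ 2\<close> is dictated by the auction, whose measure starts at no
  more than \<open>n * k + 1\<close>; counting loops stay below it. The frame relative to the
  initial state is added to the invariant once and for all.\<close>

lemma runs_While:
  assumes "bsize b \<le> 20" "I \<sigma>\<^sub>0" "\<mu> \<sigma>\<^sub>0 \<le> S ^ 2"
    and step: "\<And>\<sigma>. bounded_by S \<sigma> \<Longrightarrow> \<forall>z. z \<notin> writes c \<longrightarrow> \<sigma> z = \<sigma>\<^sub>0 z \<Longrightarrow> I \<sigma> \<Longrightarrow> bval b \<sigma> \<Longrightarrow>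
      runs c \<sigma> (\<lambda>\<tau>. I \<tau> \<and> \<mu> \<tau> < (\<mu> \<sigma> :: nat))"
    and exit: "\<And>\<sigma>. bounded_by S \<sigma> \<Longrightarrow> \<forall>z. z \<notin> writes c \<longrightarrow> \<sigma> z = \<sigma>\<^sub>0 z \<Longrightarrow> I \<sigma> \<Longrightarrow> \<not> bval b \<sigma> \<Longrightarrow> Q \<sigma>"
  shows "runs (While b c) \<sigma>\<^sub>0 Q"
  unfolding runs_def
proof
  assume bd: "bounded_by S \<sigma>\<^sub>0"
  let ?J = "\<lambda>\<sigma>. I \<sigma> \<and> (\<forall>z. z \<notin> writes c \<longrightarrow> \<sigma> z = \<sigma>\<^sub>0 z)"
  have "runs c \<sigma> (\<lambda>\<tau>. ?J \<tau> \<and> \<mu> \<tau> < \<mu> \<sigma>)" if "bounded_by S \<sigma>" "?J \<sigma>" "bval b \<sigma>" for \<sigma>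
    using that by (intro runs_conseq[OF step[of \<sigma>]]) auto
  from exec_While[where I = ?J and \<mu> = \<mu>, OF assms(1) this bd _ assms(3)] assms(2)
  obtain t \<tau> where 1: "exec oa oc (While b c) \<sigma>\<^sub>0 t \<tau>" "t \<le> S ^ 2 * (K + cost c * S ^ depth c * K) + K"
      "bounded_by S \<tau>" "?J \<tau>" "\<not> bval b \<tau>"
    by blast
  \<comment> \<open>The 2 in \<open>cost (While b c)\<close> pays for the guard: one share for the
    at most \<open>S ^ 2\<close> successful tests, one for the final failing test.\<close>
  have "1 \<le> S ^ (depth c + 2)" using S_pos by simp
  then have "K \<le> S ^ (depth c + 2) * K" by simp
  moreover have "S ^ 2 * K \<le> S ^ (depth c + 2) * K"
    using S_power_mono[of 2 "depth c + 2" 1] by simp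
  moreover have "S ^ 2 * (K + cost c * S ^ depth c * K) + K =
      S ^ 2 * K + cost c * S ^ (depth c + 2) * K + K"
    by (simp add: algebra_simps power_add power2_eq_square)
  moreover have "cost (While b c) * S ^ depth (While b c) * K =
      S ^ (depth c + 2) * K + S ^ (depth c + 2) * K + cost c * S ^ (depth c + 2) * K"
    by (simp add: algebra_simps)
  ultimately have "t \<le> cost (While b c) * S ^ depth (While b c) * K"
    using 1(2) by linarith
  then show "\<exists>t \<tau>. exec oa oc (While b c) \<sigma>\<^sub>0 t \<tau> \<and>
      t \<le> cost (While b c) * S ^ depth (While b c) * K \<and> bounded_by S \<tau> \<and> Q \<tau>"
    using 1 exit by blast
qed

text \<open>The invariant is indexed by the counter; in \<open>step\<close> it is claimed for
  \<open>upd x 0 (Suc i) \<tau>\<close> because the increment follows the body. \<open>W\<close>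
  lets the write set appear as an explicit finite set, on which the simplifier decides frame
  conditions.\<close>

lemma runs_For:
  assumes "\<sigma>\<^sub>0 y 0 = l" "y \<notin> W" "x \<notin> W" "x \<noteq> y" "l + 2 \<le> S" "writes c = W"
    and init: "I 0 (upd x 0 0 \<sigma>\<^sub>0)"
    and step: "\<And>\<sigma> i. i < l \<Longrightarrow> bounded_by S \<sigma> \<Longrightarrow> \<forall>z. z \<notin> insert x W \<longrightarrow> \<sigma> z = \<sigma>\<^sub>0 z \<Longrightarrow>
      \<sigma> x 0 = i \<Longrightarrow> I i \<sigma> \<Longrightarrow> runs c \<sigma> (\<lambda>\<tau>. I (Suc i) (upd x 0 (Suc i) \<tau>))"
    and exit: "\<And>\<sigma>. bounded_by S \<sigma> \<Longrightarrow> \<forall>z. z \<notin> insert x W \<longrightarrow> \<sigma> z = \<sigma>\<^sub>0 z \<Longrightarrow> I l \<sigma> \<Longrightarrow> Q \<sigma>"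
  shows "runs (For x y c) \<sigma>\<^sub>0 Q"
  unfolding For_def
proof (intro runs_Seq runs_Write; (simp; fail)?)
  let ?I = "\<lambda>\<sigma>. \<sigma> x 0 \<le> l \<and> I (\<sigma> x 0) \<sigma>"
  let ?\<sigma> = "upd x (aval (N 0) \<sigma>\<^sub>0) (aval (N 0) \<sigma>\<^sub>0) \<sigma>\<^sub>0"
  show "runs (While (Less (var x) (var y)) (Seq c (assign x (Plus (var x) (N 1))))) ?\<sigma> Q"
  proof (rule runs_While[where I = ?I and \<mu> = "\<lambda>\<sigma>. l - \<sigma> x 0"])
    have "l \<le> S * S" using assms(5) by (metis add_leD1 le_square le_trans)
    then show "l - ?\<sigma> x 0 \<le> S\<^sup>2" by (simp add: power2_eq_square)
    fix \<sigma>
    assume *: "bounded_by S \<sigma>" "?I \<sigma>"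
      "\<forall>z. z \<notin> writes (Seq c (assign x (Plus (var x) (N 1)))) \<longrightarrow> \<sigma> z = ?\<sigma> z"
    then have y: "\<sigma> y 0 = l" using assms(1-6) by simp
    have fr: "\<forall>z. z \<notin> insert x W \<longrightarrow> \<sigma> z = \<sigma>\<^sub>0 z" using * assms(6) by simp
    show "Q \<sigma>" if "\<not> bval (Less (var x) (var y)) \<sigma>"
      using that y * fr by (intro exit) auto
    assume b: "bval (Less (var x) (var y)) \<sigma>"
    show "runs (Seq c (assign x (Plus (var x) (N 1)))) \<sigma> (\<lambda>\<tau>. ?I \<tau> \<and> l - \<tau> x 0 < l - \<sigma> x 0)"
    proof (rule runs_Seq, rule runs_conseq[OF step])
      show "\<sigma> x 0 < l" using b y by simp
      show "bounded_by S \<sigma>" by (rule *(1))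
      show "\<forall>z. z \<notin> insert x W \<longrightarrow> \<sigma> z = \<sigma>\<^sub>0 z" by (rule fr)
      show "I (\<sigma> x 0) \<sigma>" using *(2) by simp
      fix \<tau>
      assume t: "\<forall>z. z \<notin> writes c \<longrightarrow> \<tau> z = \<sigma> z" "I (Suc (\<sigma> x 0)) (upd x 0 (Suc (\<sigma> x 0)) \<tau>)"
      then have "\<tau> x = \<sigma> x" using assms(3,6) by simp
      then show "runs (assign x (Plus (var x) (N 1))) \<tau> (\<lambda>\<tau>. ?I \<tau> \<and> l - \<tau> x 0 < l - \<sigma> x 0)"
        using t(2) b y assms(5) by (intro runs_Write) auto
    qed simp
  qed (use init in simp_all)
qed

end

section \<open>Matching by auction\<close>

definition same_kernel :: "nat \<Rightarrow> (nat \<Rightarrow> nat) \<Rightarrow> (nat \<Rightarrow> nat) \<Rightarrow> bool" where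
  "same_kernel k f g \<longleftrightarrow> (\<forall>i<k. \<forall>j<k. f i = f j \<longleftrightarrow> g i = g j)"

definition allowed :: "(nat \<Rightarrow> nat \<Rightarrow> bool) \<Rightarrow> nat \<Rightarrow> (nat \<Rightarrow> nat) \<Rightarrow> nat \<Rightarrow> nat \<Rightarrow> bool" where
  "allowed auth k f b u \<longleftrightarrow> (\<forall>i<k. f i = f b \<longrightarrow> auth i u)"

text \<open>The tasks with the same \<open>f\<close>-value form a block, and the blocks bid for the users. An
  unassigned block takes the cheapest user allowed for it, evicts the previous owner and raises
  the price by 1. The last conjunct says that every owner pays at most 1 more than the cheapest
  user would cost.\<close>

definition auction :: "(nat \<Rightarrow> nat \<Rightarrow> bool) \<Rightarrow> nat \<Rightarrow> nat \<Rightarrow> (nat \<Rightarrow> nat) \<Rightarrow> (nat \<Rightarrow> nat) \<Rightarrow> (nat \<Rightarrow> nat) \<Rightarrow> bool" where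
  "auction auth n k f pl p \<longleftrightarrow>
     (\<forall>i<k. pl i \<le> n) \<and> (\<forall>u<n. p u \<le> k) \<and>
     (\<forall>i<k. \<forall>j<k. f i = f j \<longrightarrow> pl i = pl j) \<and>
     (\<forall>i<k. \<forall>j<k. pl i < n \<and> pl i = pl j \<longrightarrow> f i = f j) \<and>
     (\<forall>i<k. pl i < n \<longrightarrow> allowed auth k f i (pl i)) \<and>
     (\<forall>u<n. 0 < p u \<longrightarrow> (\<exists>i<k. pl i = u)) \<and>
     (\<forall>i<k. \<forall>u<n. pl i < n \<and> allowed auth k f i u \<longrightarrow> p (pl i) \<le> p u + 1)"

lemma auction_init: "\<forall>i<k. pl i = n \<Longrightarrow> \<forall>u<n. p u = 0 \<Longrightarrow> auction auth n k f pl p"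
  by (simp add: auction_def)

lemma allowed_cong: "f i = f j \<Longrightarrow> allowed auth k f i = allowed auth k f j"
  by (simp add: allowed_def fun_eq_iff)

text \<open>Only the price of \<open>u\<close> changes. The block of \<open>b\<close> pays one more
  than the cheapest price available to it, which is the permitted slack; every other owner keeps its
  price while the alternatives get no cheaper. A user once owned stays owned, since eviction happens
  only in favour of a new owner.\<close>

lemma auction_step:
  assumes a: "auction auth n k f pl p"
    and b: "b < k" "pl b = n" "u < n" "allowed auth k f b u" "p u < k"
    and cheapest: "\<forall>v<n. allowed auth k f b v \<longrightarrow> p u \<le> p v"
    and pl': "\<forall>i<k. pl' i = (if f i = f b then u else if pl i = u then n else pl i)"
  shows "auction auth n k f pl' (p(u := p u + 1))"
proof -
  have le: "\<And>i. i < k \<Longrightarrow> pl i \<le> n" and price: "\<And>v. v < n \<Longrightarrow> p v \<le> k"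
    and const: "\<And>i j. i < k \<Longrightarrow> j < k \<Longrightarrow> f i = f j \<Longrightarrow> pl i = pl j"
    and inj: "\<And>i j. i < k \<Longrightarrow> j < k \<Longrightarrow> pl i < n \<Longrightarrow> pl i = pl j \<Longrightarrow> f i = f j"
    and ok: "\<And>i. i < k \<Longrightarrow> pl i < n \<Longrightarrow> allowed auth k f i (pl i)"
    and owner: "\<And>v. v < n \<Longrightarrow> 0 < p v \<Longrightarrow> \<exists>i<k. pl i = v"
    and slack: "\<And>i v. i < k \<Longrightarrow> v < n \<Longrightarrow> pl i < n \<Longrightarrow> allowed auth k f i v \<Longrightarrow> p (pl i) \<le> p v + 1"
    using a unfolding auction_def by blast+
  have blk: "pl i = n" if "i < k" "f i = f b" for i using const that b by metis
  have in_b: "pl' i = u" if "i < k" "f i = f b" for i using pl' that by simp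
  have out_b: "pl' i = pl i \<and> pl i \<noteq> u" if "i < k" "f i \<noteq> f b" "pl' i < n" for i
    using pl' that by (metis less_irrefl)
  show ?thesis
    unfolding auction_def
  proof (intro conjI allI impI)
    fix i assume i: "i < k"
    show "pl' i \<le> n" using le[OF i] b(3) pl' i by simp
  next
    fix v assume "v < n"
    then show "(p(u := p u + 1)) v \<le> k" using price b(5) by simp
  next
    fix i j assume "i < k" "j < k" "f i = f j"
    then show "pl' i = pl' j" using const[of i j] pl' by simp
  next
    fix i j assume ij: "i < k" "j < k" "pl' i < n \<and> pl' i = pl' j"
    then show "f i = f j"
      using in_b out_b inj[of i j] by (cases "f i = f b"; cases "f j = f b") metis+
  next
    fix i assume i: "i < k" "pl' i < n"
    show "allowed auth k f i (pl' i)"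
    proof (cases "f i = f b")
      case True
      then show ?thesis using in_b i b(4) allowed_cong[of f i b] by metis
    next
      case False
      then show ?thesis using out_b ok i by metis
    qed
  next
    fix v assume v: "v < n" "0 < (p(u := p u + 1)) v"
    show "\<exists>i<k. pl' i = v"
    proof (cases "v = u")
      case True
      then show ?thesis using pl' b(1) by auto
    next
      case False
      then obtain i where i: "i < k" "pl i = v" using owner[of v] v by auto
      then have "f i \<noteq> f b" using blk v(1) by blast
      then show ?thesis using pl' i False by auto
    qed
  next
    fix i v assume iv: "i < k" "v < n" "pl' i < n \<and> allowed auth k f i v"
    show "(p(u := p u + 1)) (pl' i) \<le> (p(u := p u + 1)) v + 1"
    proof (cases "f i = f b")
      case True
      then have "allowed auth k f b v" using iv allowed_cong[of f i b] by metis
      then show ?thesis using True iv in_b cheapest by auto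
    next
      case False
      then have i: "pl' i = pl i" "pl i \<noteq> u" using iv out_b[of i] by blast+
      then have "p (pl i) \<le> p v + 1" using slack iv by auto
      then show ?thesis using i by auto
    qed
  qed
qed

text \<open>If a block has no allowed user of price below \<open>k\<close>, Hall's condition fails: for
  \<open>D j = {u. j \<le> p u}\<close>, an assignment \<open>h\<close> would send the owners of \<open>D (j + 1)\<close> together with
  the block of \<open>b\<close> injectively into \<open>D j\<close>, so \<open>D 1\<close> would have at least \<open>k\<close> elements, one for
  each assigned block.\<close>

lemma auction_stuck:
  assumes a: "auction auth n k f pl p"
    and b: "b < k" "pl b = n" "\<forall>u<n. allowed auth k f b u \<longrightarrow> k \<le> p u"
    and h: "\<forall>i<k. h i < n \<and> auth i (h i)" "same_kernel k h f"
  shows False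
proof -
  note A = a[unfolded auction_def]
  define D where "D j = {u. u < n \<and> j \<le> p u}" for j
  have fin: "finite (D j)" for j by (simp add: D_def)
  have all: "allowed auth k f i (h i)" if "i < k" for i
    using h that unfolding allowed_def same_kernel_def by metis
  have "\<forall>u\<in>D 1. \<exists>i<k. pl i = u" using A by (auto simp: D_def)
  then obtain ow where ow: "\<And>u. u \<in> D 1 \<Longrightarrow> ow u < k \<and> pl (ow u) = u" by metis
  have D1: "D j \<subseteq> D 1" if "1 \<le> j" for j using that by (auto simp: D_def)
  have step: "card (D (Suc j)) + 1 \<le> card (D j)" if j: "j < k" for j
  proof -
    have sub: "D (Suc j) \<subseteq> D 1" by (rule D1) simp
    have inj: "inj_on (\<lambda>u. h (ow u)) (D (Suc j))"
    proof (rule inj_onI)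
      fix u v assume uv: "u \<in> D (Suc j)" "v \<in> D (Suc j)" "h (ow u) = h (ow v)"
      then have o: "ow u < k \<and> pl (ow u) = u" "ow v < k \<and> pl (ow v) = v" using sub ow by blast+
      then have "f (ow u) = f (ow v)" using uv(3) h(2) by (auto simp: same_kernel_def)
      then show "u = v" using A o by metis
    qed
    have nb: "h b \<notin> (\<lambda>u. h (ow u)) ` D (Suc j)"
    proof
      assume "h b \<in> (\<lambda>u. h (ow u)) ` D (Suc j)"
      then obtain u where u: "u \<in> D (Suc j)" "h b = h (ow u)" by blast
      then have o: "ow u < k \<and> pl (ow u) = u" using sub ow by blast
      then have "f b = f (ow u)" using u b h(2) by (auto simp: same_kernel_def)
      then have "u = n" using A o b by metis
      then show False using u by (simp add: D_def)
    qed
    \<comment> \<open>Every user allowed for the block of \<open>b\<close> costs at least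
      \<open>k\<close>, which exceeds \<open>j\<close>.\<close>
    have "h b \<in> D j" using b all[OF b(1)] h(1) j by (auto simp: D_def)
    moreover have "h (ow u) \<in> D j" if u: "u \<in> D (Suc j)" for u
    proof -
      have o: "ow u < k" "pl (ow u) = u" "u < n" "Suc j \<le> p u"
        using u sub ow by (blast, blast, simp_all add: D_def)
      \<comment> \<open>The owner of \<open>u\<close> pays at least \<open>Suc j\<close> and at most
        1 more than any allowed user costs, so \<open>h (ow u)\<close> costs at least
        \<open>j\<close>. The slack of 1 is exactly the step from \<open>D (Suc j)\<close> to
        \<open>D j\<close>.\<close>
      then have "p u \<le> p (h (ow u)) + 1" using A all h(1) by metis
      then show ?thesis using o h(1) by (auto simp: D_def)
    qed
    ultimately have "insert (h b) ((\<lambda>u. h (ow u)) ` D (Suc j)) \<subseteq> D j" by auto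
    then have "card (insert (h b) ((\<lambda>u. h (ow u)) ` D (Suc j))) \<le> card (D j)"
      using fin by (intro card_mono)
    then show ?thesis using nb inj fin by (simp add: card_image)
  qed
  have "h b \<in> D k" using b all[OF b(1)] h(1) by (auto simp: D_def)
  then have Dk: "1 \<le> card (D k)" using fin by (metis One_nat_def Suc_leI card_gt_0_iff empty_iff)
  have "j + 1 \<le> card (D (k - j))" if "j \<le> k - 1" for j
    using that
  proof (induction j)
    case (Suc j)
    then have "Suc (k - Suc j) = k - j" by simp
    then show ?case using Suc step[of "k - Suc j"] by simp
  qed (use Dk in simp)
  from this[of "k - 1"] have "k \<le> card (D 1)" using b(1) by simp
  \<comment> \<open>Users of positive price have pairwise distinct owners, and \<open>b\<close> owns
    nothing, which leaves at most \<open>k - 1\<close> of them.\<close>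
  moreover have "card (D 1) \<le> card ({..<k} - {b})"
  proof (rule card_inj_on_le)
    show "inj_on ow (D 1)" using ow by (metis inj_onI)
    show "ow ` D 1 \<subseteq> {..<k} - {b}" using ow b(2) by (fastforce simp: D_def)
  qed simp
  ultimately show False using b(1) by simp
qed

lemma auction_complete:
  assumes "auction auth n k f pl p" "\<forall>i<k. pl i \<noteq> n"
  shows "\<forall>i<k. pl i < n \<and> auth i (pl i)" "same_kernel k pl f"
proof -
  have le: "\<And>i. i < k \<Longrightarrow> pl i \<le> n"
    and const: "\<And>i j. i < k \<Longrightarrow> j < k \<Longrightarrow> f i = f j \<Longrightarrow> pl i = pl j"
    and inj: "\<And>i j. i < k \<Longrightarrow> j < k \<Longrightarrow> pl i < n \<Longrightarrow> pl i = pl j \<Longrightarrow> f i = f j"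
    and ok: "\<And>i. i < k \<Longrightarrow> pl i < n \<Longrightarrow> allowed auth k f i (pl i)"
    using assms(1) unfolding auction_def by blast+
  have lt: "pl i < n" if "i < k" for i
    using le[OF that] assms(2) that by (simp add: le_neq_implies_less)
  show "\<forall>i<k. pl i < n \<and> auth i (pl i)"
    using lt ok by (simp add: allowed_def)
  show "same_kernel k pl f"
    unfolding same_kernel_def
  proof (intro allI impI iffI)
    fix i j assume ij: "i < k" "j < k"
    show "f i = f j" if "pl i = pl j" by (rule inj[OF ij lt[OF ij(1)] that])
    show "pl i = pl j" if "f i = f j" by (rule const[OF ij that])
  qed
qed

section \<open>Functions into \<open>{0..<k}\<close> as base-\<open>k\<close> numerals\<close>

definition digits_value :: "nat \<Rightarrow> (nat \<Rightarrow> nat) \<Rightarrow> nat" where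
  "digits_value k f = (\<Sum>i<k. f i * k ^ i)"

text \<open>The number \<open>l\<close> of digits is separated from the base \<open>k\<close>,
  because the induction adds digits while the base is fixed.\<close>

lemma sum_digits_less: "\<forall>i<l. f i < k \<Longrightarrow> (\<Sum>i<l. f i * k ^ i) < (k::nat) ^ l"
proof (induction l)
  case (Suc l)
  then have "(\<Sum>i<l. f i * k ^ i) < k ^ l" by simp
  moreover have "(f l + 1) * k ^ l \<le> k * k ^ l" using Suc.prems by (intro mult_le_mono1) (simp add: Suc_leI)
  ultimately show ?case by simp
qed simp

text \<open>Division by \<open>k ^ l\<close> recovers the top digit, since the lower digits together
  stay below \<open>k ^ l\<close>.\<close>

lemma sum_digits_inj:
  "\<forall>i<l. f i < k \<Longrightarrow> \<forall>i<l. g i < k \<Longrightarrow> (\<Sum>i<l. f i * k ^ i) = (\<Sum>i<l. g i * (k::nat) ^ i) \<Longrightarrow>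
    \<forall>i<l. f i = g i"
proof (induction l)
  case (Suc l)
  let ?F = "\<Sum>i<l. f i * k ^ i" and ?G = "\<Sum>i<l. g i * k ^ i"
  have *: "?F < k ^ l" "?G < k ^ l" using Suc.prems by (auto intro!: sum_digits_less)
  have eq: "?F + f l * k ^ l = ?G + g l * k ^ l" using Suc.prems(3) by simp
  have "k ^ l \<noteq> 0" using * by linarith
  note div = div_mult_self1[OF this]
  have "f l = (?F + f l * k ^ l) div k ^ l" using div[of ?F "f l"] div_less[OF *(1)] by simp
  also have "\<dots> = g l" using eq div[of ?G "g l"] div_less[OF *(2)] by simp
  finally have fg: "f l = g l" .
  then have "?F = ?G" using eq by simp
  then have "\<forall>i<l. f i = g i" using Suc.prems(1,2) by (intro Suc.IH) simp_all
  with fg show ?case using less_Suc_eq by metis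
qed simp

lemma digits_value_less: "\<forall>i<k. f i < k \<Longrightarrow> digits_value k f < k ^ k"
  unfolding digits_value_def by (rule sum_digits_less)

lemma digits_value_inj:
  "\<forall>i<k. f i < k \<Longrightarrow> \<forall>i<k. g i < k \<Longrightarrow> digits_value k f = digits_value k g \<Longrightarrow> \<forall>i<k. f i = g i"
  unfolding digits_value_def by (rule sum_digits_inj)

text \<open>The change of value is written with sums on both sides because subtraction on
  \<open>nat\<close> truncates.\<close>

lemma digits_value_upd:
  assumes "i < k"
  shows "digits_value k (f(i := v)) + f i * k ^ i = digits_value k f + v * k ^ i"
proof -
  have "digits_value k (f(i := v)) = v * k ^ i + (\<Sum>j\<in>{..<k} - {i}. (f(i := v)) j * k ^ j)"
    unfolding digits_value_def using assms by (subst sum.remove[of _ i]) auto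
  also have "(\<Sum>j\<in>{..<k} - {i}. (f(i := v)) j * k ^ j) = (\<Sum>j\<in>{..<k} - {i}. f j * k ^ j)"
    by (rule sum.cong) auto
  finally have *: "digits_value k (f(i := v)) = v * k ^ i + \<dots>" .
  have "digits_value k f = f i * k ^ i + (\<Sum>j\<in>{..<k} - {i}. f j * k ^ j)"
    unfolding digits_value_def using assms by (subst sum.remove[of _ i]) auto
  with * show ?thesis by simp
qed

section \<open>The solver\<close>

definition check_block :: com where
  "check_block = Seq (assign ''ok'' (N 1))
     (For ''i'' ''k'' (If (Eq (Rd ''f'' (var ''i'')) (Rd ''f'' (var ''b'')))
        (Seq (AuthQ ''r'' (var ''i'') (var ''u''))
          (If (Eq (var ''r'') (N 0)) (assign ''ok'' (N 0)) Skip))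
        Skip))"

text \<open>\<open>''w''\<close> starts at \<open>k\<close>, so only users of price below
  \<open>k\<close> qualify; \<open>''best''\<close> equal to \<open>n\<close> means that there is
  none.\<close>

definition find_user :: com where
  "find_user = Seq (assign ''best'' (var ''n'')) (Seq (assign ''w'' (var ''k''))
     (For ''u'' ''n'' (Seq check_block
        (If (Conj (Eq (var ''ok'') (N 1)) (Less (Rd ''price'' (var ''u'')) (var ''w'')))
          (Seq (assign ''best'' (var ''u'')) (assign ''w'' (Rd ''price'' (var ''u''))))
          Skip))))"

definition find_task :: com where
  "find_task = Seq (assign ''b'' (var ''k''))
     (For ''i'' ''k'' (If (Eq (Rd ''plan'' (var ''i'')) (var ''n'')) (assign ''b'' (var ''i'')) Skip))"

definition reassign :: com where
  "reassign = Seq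
     (For ''i'' ''k''
        (If (Eq (Rd ''f'' (var ''i'')) (Rd ''f'' (var ''b'')))
          (Write ''plan'' (var ''i'') (var ''best''))
          (If (Eq (Rd ''plan'' (var ''i'')) (var ''best'')) (Write ''plan'' (var ''i'') (var ''n'')) Skip)))
     (Write ''price'' (var ''best'') (Plus (Rd ''price'' (var ''best'')) (N 1)))"

text \<open>\<open>''st''\<close> is 0 while the auction runs, 1 when every task has a user, and 2
  when the kernel is refuted. The entry \<open>n\<close>, which is no user position, marks an
  unassigned task.\<close>

definition match_pattern :: com where
  "match_pattern =
     Seq (For ''i'' ''k'' (Write ''plan'' (var ''i'') (var ''n'')))
    (Seq (For ''u'' ''n'' (Write ''price'' (var ''u'') (N 0)))
    (Seq (assign ''st'' (N 0))
    (While (Eq (var ''st'') (N 0))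
      (Seq find_task
        (If (Eq (var ''b'') (var ''k'')) (assign ''st'' (N 1))
          (Seq find_user
            (If (Eq (var ''best'') (var ''n'')) (assign ''st'' (N 2)) reassign)))))))"

definition check_constraints :: com where
  "check_constraints = Seq (assign ''ok'' (N 1))
     (For ''c'' ''m'' (Seq (ConQ ''r'' (var ''c'') ''plan'')
        (If (Eq (var ''r'') (N 0)) (assign ''ok'' (N 0)) Skip)))"

text \<open>A base-\<open>k\<close> counter, least significant digit at index 0. Stored digit by
  digit, it keeps every cell below \<open>k\<close>, although the number it represents may be
  exponential. A carry out of the last digit means that all patterns are exhausted and becomes the
  halting flag.\<close>

definition next_pattern :: com where
  "next_pattern = Seq (assign ''carry'' (N 1))
    (Seq (For ''i'' ''k'' (If (Eq (var ''carry'') (N 1))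
        (If (Eq (Plus (Rd ''f'' (var ''i'')) (N 1)) (var ''k''))
          (Write ''f'' (var ''i'') (N 0))
          (Seq (Write ''f'' (var ''i'') (Plus (Rd ''f'' (var ''i'')) (N 1))) (assign ''carry'' (N 0))))
        Skip))
    (assign ''halt'' (var ''carry'')))"

definition try_pattern :: com where
  "try_pattern = Seq match_pattern
     (If (Eq (var ''st'') (N 1))
       (Seq check_constraints
         (If (Eq (var ''ok'') (N 1)) (Seq (assign ''found'' (N 1)) (assign ''halt'' (N 1))) next_pattern))
       next_pattern)"

definition solver :: com where
  "solver = While (Eq (var ''halt'') (N 0)) try_pattern"

text \<open>The invariant of \<open>find_user\<close> after \<open>j\<close> users. At
  \<open>j = n\<close> its two cases provide the hypotheses of \<open>auction_stuck\<close>
  (\<open>best = n\<close>) and of \<open>auction_step\<close> (\<open>best < n\<close>).\<close>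

definition cheapest :: "(nat \<Rightarrow> bool) \<Rightarrow> (nat \<Rightarrow> nat) \<Rightarrow> nat \<Rightarrow> nat \<Rightarrow> nat \<Rightarrow> nat \<Rightarrow> nat \<Rightarrow> bool" where
  "cheapest al p n k j best w \<longleftrightarrow> w \<le> k \<and> (\<forall>v<j. al v \<longrightarrow> w \<le> p v) \<and>
     (best = n \<and> w = k \<or> best < n \<and> al best \<and> w = p best \<and> w < k)"

lemma cheapest_take: "cheapest al p n k j best w \<Longrightarrow> j < n \<Longrightarrow> al j \<Longrightarrow> p j < w \<Longrightarrow> cheapest al p n k (Suc j) j (p j)"
  unfolding cheapest_def less_Suc_eq by (auto intro: less_imp_le less_le_trans)

lemma cheapest_skip: "cheapest al p n k j best w \<Longrightarrow> \<not> (al j \<and> p j < w) \<Longrightarrow> cheapest al p n k (Suc j) best w"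
  unfolding cheapest_def less_Suc_eq by auto

context wsp_machine
begin

lemma plus_2_le_S: "n + 2 \<le> S" "k + 2 \<le> S" "m + 2 \<le> S" by (simp_all add: S_def)

lemma bounded_byD: "bounded_by S \<sigma> \<Longrightarrow> \<sigma> x i \<le> S"
  by (simp add: bounded_by_def)

lemmas runs_atoms = runs_Write runs_AuthQ runs_ConQ runs_Skip

lemma runs_check_block:
  assumes "\<sigma> ''k'' 0 = k" "\<sigma> ''u'' 0 < n"
    and "\<And>\<tau>. bounded_by S \<tau> \<Longrightarrow> \<forall>z. z \<notin> {''ok'', ''i'', ''r''} \<longrightarrow> \<tau> z = \<sigma> z \<Longrightarrow>
      \<tau> ''ok'' 0 = of_bool (allowed auth k (\<sigma> ''f'') (\<sigma> ''b'' 0) (\<sigma> ''u'' 0)) \<Longrightarrow> Q \<tau>"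
  shows "runs check_block \<sigma> Q"
  unfolding check_block_def
proof (rule runs_Seq, rule runs_Write, simp, simp, simp add: S_def, rule runs_For[where l = k
    and W = "{''ok'', ''r''}" and I = "\<lambda>i \<tau>. \<tau> ''ok'' 0 =
      of_bool (\<forall>j<i. \<sigma> ''f'' j = \<sigma> ''f'' (\<sigma> ''b'' 0) \<longrightarrow> auth j (\<sigma> ''u'' 0))"], goal_cases)
  \<comment> \<open>Here and in the counting loops below, goal 8 of \<open>runs_For\<close> is the
    loop body and goal 9 the exit.\<close>
  case (8 \<tau> i)
  then have "\<tau> ''f'' = \<sigma> ''f''" "\<tau> ''b'' = \<sigma> ''b''" "\<tau> ''u'' = \<sigma> ''u''" by simp_all
  then show ?case using 8(2,5,6) assms(2)
    by (intro runs_If runs_Seq runs_atoms) (auto simp: less_Suc_eq)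
next
  case (9 \<tau>)
  then show ?case by (intro assms(3)) (auto simp: allowed_def)
qed (use assms(1) plus_2_le_S in auto)

lemma runs_find_task:
  assumes "\<sigma> ''k'' 0 = k" "\<sigma> ''n'' 0 = n"
    and "\<And>\<tau>. bounded_by S \<tau> \<Longrightarrow> \<forall>z. z \<notin> {''b'', ''i''} \<longrightarrow> \<tau> z = \<sigma> z \<Longrightarrow>
      (\<tau> ''b'' 0 = k \<and> (\<forall>i<k. \<sigma> ''plan'' i \<noteq> n)) \<or> (\<tau> ''b'' 0 < k \<and> \<sigma> ''plan'' (\<tau> ''b'' 0) = n) \<Longrightarrow> Q \<tau>"
  shows "runs find_task \<sigma> Q"
  unfolding find_task_def
proof (rule runs_Seq, rule runs_Write, simp, simp, simp add: assms S_def, rule runs_For[where l = k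
    and W = "{''b''}" and I = "\<lambda>i \<tau>. (\<tau> ''b'' 0 = k \<and> (\<forall>j<i. \<sigma> ''plan'' j \<noteq> n)) \<or>
      (\<tau> ''b'' 0 < k \<and> \<sigma> ''plan'' (\<tau> ''b'' 0) = n)"], goal_cases)
  case (8 \<tau> i)
  then have "\<tau> ''plan'' = \<sigma> ''plan''" "\<tau> ''n'' = \<sigma> ''n''" by simp_all
  then show ?case using 8(2,5,6) assms(2) plus_2_le_S
    by (intro runs_If runs_Seq runs_atoms) (auto simp: less_Suc_eq)
next
  case (9 \<tau>)
  then show ?case by (intro assms(3)) auto
qed (use assms(1) plus_2_le_S in auto)

lemma runs_find_user:
  assumes "\<sigma> ''k'' 0 = k" "\<sigma> ''n'' 0 = n"
    and "\<And>\<tau>. bounded_by S \<tau> \<Longrightarrow> \<forall>z. z \<notin> {''best'', ''w'', ''u'', ''ok'', ''i'', ''r''} \<longrightarrow> \<tau> z = \<sigma> z \<Longrightarrow>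
      cheapest (allowed auth k (\<sigma> ''f'') (\<sigma> ''b'' 0)) (\<sigma> ''price'') n k n (\<tau> ''best'' 0) (\<tau> ''w'' 0) \<Longrightarrow> Q \<tau>"
  shows "runs find_user \<sigma> Q"
  unfolding find_user_def
proof (rule runs_Seq, rule runs_Write, simp, simp, simp add: assms S_def,
    rule runs_Seq, rule runs_Write, simp, simp, simp add: assms S_def, rule runs_For[where l = n
    and W = "{''best'', ''w'', ''ok'', ''i'', ''r''}" and I = "\<lambda>i \<tau>.
      cheapest (allowed auth k (\<sigma> ''f'') (\<sigma> ''b'' 0)) (\<sigma> ''price'') n k i (\<tau> ''best'' 0) (\<tau> ''w'' 0)"], goal_cases)
  case (8 \<tau> i)
  then have fr: "\<tau> ''f'' = \<sigma> ''f''" "\<tau> ''b'' = \<sigma> ''b''" "\<tau> ''price'' = \<sigma> ''price''" "\<tau> ''k'' = \<sigma> ''k''" by simp_all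
  show ?case
  proof (rule runs_Seq, rule runs_check_block, goal_cases)
    case (3 \<rho>)
    then have fr': "\<rho> ''best'' = \<tau> ''best''" "\<rho> ''w'' = \<tau> ''w''" "\<rho> ''u'' = \<tau> ''u''" "\<rho> ''price'' = \<sigma> ''price''"
      using fr by simp_all
    have ok: "\<rho> ''ok'' 0 = of_bool (allowed auth k (\<sigma> ''f'') (\<sigma> ''b'' 0) i)" "\<tau> ''u'' 0 = i"
      using 3(3) fr 8 by simp_all
    have "\<sigma> ''price'' i \<le> S" using 3(1) fr' bounded_byD by metis
    then have S: "\<sigma> ''price'' i \<le> S" "i \<le> S" using 8(3) plus_2_le_S by simp_all
    show ?case
    proof (cases "allowed auth k (\<sigma> ''f'') (\<sigma> ''b'' 0) i \<and> \<sigma> ''price'' i < \<tau> ''w'' 0")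
      case True
      then have "cheapest (allowed auth k (\<sigma> ''f'') (\<sigma> ''b'' 0)) (\<sigma> ''price'') n k (Suc i) i (\<sigma> ''price'' i)"
        using cheapest_take[OF 8(7,3)] by blast
      then show ?thesis using True fr' ok S
        by (intro runs_If runs_Seq runs_atoms) simp_all
    next
      case False
      then have "cheapest (allowed auth k (\<sigma> ''f'') (\<sigma> ''b'' 0)) (\<sigma> ''price'') n k (Suc i) (\<tau> ''best'' 0) (\<tau> ''w'' 0)"
        using cheapest_skip[OF 8(7)] by blast
      then show ?thesis using False fr' ok
        by (intro runs_If runs_Seq runs_atoms) simp_all
    qed
  qed (use 8(3,6) fr(4) assms(1) in simp_all)
next
  case (9 \<tau>)
  from 9(3-5) show ?case by (intro assms(3)) simp_all
qed (use assms(1,2) plus_2_le_S in \<open>auto simp: check_block_def cheapest_def\<close>)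

lemma runs_reassign:
  assumes "\<sigma> ''k'' 0 = k" "\<sigma> ''n'' 0 = n" "\<sigma> ''best'' 0 < n" "\<sigma> ''price'' (\<sigma> ''best'' 0) < k"
    and "\<And>\<tau>. bounded_by S \<tau> \<Longrightarrow> \<forall>z. z \<notin> {''i'', ''plan'', ''price''} \<longrightarrow> \<tau> z = \<sigma> z \<Longrightarrow>
      \<forall>i<k. \<tau> ''plan'' i = (if \<sigma> ''f'' i = \<sigma> ''f'' (\<sigma> ''b'' 0) then \<sigma> ''best'' 0
        else if \<sigma> ''plan'' i = \<sigma> ''best'' 0 then n else \<sigma> ''plan'' i) \<Longrightarrow>
      \<tau> ''price'' = (\<sigma> ''price'')(\<sigma> ''best'' 0 := \<sigma> ''price'' (\<sigma> ''best'' 0) + 1) \<Longrightarrow> Q \<tau>"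
  shows "runs reassign \<sigma> Q"
  unfolding reassign_def
\<comment> \<open>The invariant also fixes the entries from \<open>i\<close> on, because the
  eviction test at \<open>i\<close> has to read the old plan.\<close>
proof (rule runs_Seq, rule runs_For[where l = k and W = "{''plan''}" and I = "\<lambda>i \<tau>.
      \<tau> ''plan'' = (\<lambda>j. if j < i then if \<sigma> ''f'' j = \<sigma> ''f'' (\<sigma> ''b'' 0) then \<sigma> ''best'' 0
        else if \<sigma> ''plan'' j = \<sigma> ''best'' 0 then n else \<sigma> ''plan'' j else \<sigma> ''plan'' j)"], goal_cases)
  case (8 \<tau> i)
  from 8(3) have "\<tau> ''f'' = \<sigma> ''f''" "\<tau> ''b'' = \<sigma> ''b''" "\<tau> ''best'' = \<sigma> ''best''" "\<tau> ''n'' 0 = n"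
    using assms(2) by simp_all
  then show ?case using 8(1,4,5) assms(3) plus_2_le_S
    by (intro runs_If runs_atoms) (auto simp: fun_eq_iff less_Suc_eq)
next
  case (9 \<tau>)
  from 9(2) have fr: "\<tau> ''price'' = \<sigma> ''price''" "\<tau> ''best'' = \<sigma> ''best''" by simp_all
  show ?case
  proof (rule runs_Write, goal_cases)
    case 4
    show ?case
    proof (rule assms(5))
      show "bounded_by S (upd ''price'' (aval (var ''best'') \<tau>)
          (aval (Plus (Rd ''price'' (var ''best'')) (N 1)) \<tau>) \<tau>)"
        using 9(1) fr assms(4) plus_2_le_S by (intro bounded_by_upd) auto
    qed (use 9(2,3) fr in auto)
  qed (use fr assms(4) plus_2_le_S in auto)
qed (use assms(1,2) plus_2_le_S in auto)

lemma runs_check_constraints: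
  assumes "\<sigma> ''m'' 0 = m"
    and "\<And>\<tau>. bounded_by S \<tau> \<Longrightarrow> \<forall>z. z \<notin> {''ok'', ''c'', ''r''} \<longrightarrow> \<tau> z = \<sigma> z \<Longrightarrow>
      \<tau> ''ok'' 0 = of_bool (\<forall>c<m. con c (\<sigma> ''plan'')) \<Longrightarrow> Q \<tau>"
  shows "runs check_constraints \<sigma> Q"
  unfolding check_constraints_def
proof (rule runs_Seq, rule runs_Write, simp, simp, simp add: S_def, rule runs_For[where l = m
    and W = "{''ok'', ''r''}" and I = "\<lambda>i \<tau>. \<tau> ''ok'' 0 = of_bool (\<forall>c<i. con c (\<sigma> ''plan''))"], goal_cases)
  case (8 \<tau> i)
  then have "\<tau> ''plan'' = \<sigma> ''plan''" by simp_all
  then show ?case using 8(2,5,6)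
    by (intro runs_If runs_Seq runs_atoms) (auto simp: less_Suc_eq)
next
  case (9 \<tau>)
  then show ?case by (intro assms(2)) auto
qed (use assms(1) plus_2_le_S in auto)

lemma runs_next_pattern:
  assumes "\<sigma> ''k'' 0 = k" "\<forall>i<k. \<sigma> ''f'' i < k"
    and "\<And>\<tau>. bounded_by S \<tau> \<Longrightarrow> \<forall>z. z \<notin> {''carry'', ''i'', ''f'', ''halt''} \<longrightarrow> \<tau> z = \<sigma> z \<Longrightarrow>
      \<forall>i<k. \<tau> ''f'' i < k \<Longrightarrow> \<tau> ''halt'' 0 \<le> 1 \<Longrightarrow>
      digits_value k (\<tau> ''f'') + \<tau> ''halt'' 0 * k ^ k = digits_value k (\<sigma> ''f'') + 1 \<Longrightarrow> Q \<tau>"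
  shows "runs next_pattern \<sigma> Q"
  unfolding next_pattern_def
\<comment> \<open>After \<open>i\<close> digits a pending carry is worth \<open>k ^ i\<close>, so
  value plus carry remains the old value plus 1. At \<open>i = k\<close> the carry is the overflow
  \<open>k ^ k\<close>.\<close>
proof (rule runs_Seq, rule runs_Write, simp, simp, simp add: S_def, rule runs_Seq, rule runs_For[where l = k
    and W = "{''carry'', ''f''}" and I = "\<lambda>i \<tau>. (\<forall>j<k. \<tau> ''f'' j < k) \<and> \<tau> ''carry'' 0 \<le> 1 \<and>
      digits_value k (\<tau> ''f'') + \<tau> ''carry'' 0 * k ^ i = digits_value k (\<sigma> ''f'') + 1"], goal_cases)
  case (8 \<tau> i)
  from 8(4) have k: "\<tau> ''k'' 0 = k" using assms(1) by simp
  from 8(6) have f: "\<forall>j<k. \<tau> ''f'' j < k" and carry: "\<tau> ''carry'' 0 \<le> 1"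
    and val: "digits_value k (\<tau> ''f'') + \<tau> ''carry'' 0 * k ^ i = digits_value k (\<sigma> ''f'') + 1"
    by blast+
  have up: "digits_value k ((\<tau> ''f'')(i := v)) + \<tau> ''f'' i * k ^ i = digits_value k (\<tau> ''f'') + v * k ^ i" for v
    by (rule digits_value_upd[OF 8(2)])
  have fi: "\<tau> ''f'' i < k" using f 8(2) by blast
  consider "\<tau> ''carry'' 0 = 0" | "\<tau> ''carry'' 0 = 1" "\<tau> ''f'' i + 1 = k" | "\<tau> ''carry'' 0 = 1" "\<tau> ''f'' i + 1 < k"
    using carry fi by linarith
  then show ?case
  proof cases
    case 1
    then show ?thesis using f val by (intro runs_If runs_atoms) simp_all
  next
    case 2
    have "(\<tau> ''f'' i + 1) * k ^ i = k ^ Suc i" using 2(2) by simp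
    then have "digits_value k ((\<tau> ''f'')(i := 0)) + k ^ Suc i = digits_value k (\<sigma> ''f'') + 1"
      using up[of 0] val 2(1) by (simp add: algebra_simps)
    then show ?thesis using 2 f fi k 8(5) by (intro runs_If runs_atoms) (simp_all add: fun_upd_def)
  next
    case 3
    have "digits_value k ((\<tau> ''f'')(i := \<tau> ''f'' i + 1)) = digits_value k (\<sigma> ''f'') + 1"
      using up[of "\<tau> ''f'' i + 1"] val 3(1) by (simp add: algebra_simps)
    then show ?thesis using 3 f fi k 8(5) plus_2_le_S by (intro runs_If runs_Seq runs_atoms) (simp_all add: fun_upd_def)
  qed
next
  case (9 \<tau>)
  show ?case
  proof (rule runs_Write, goal_cases)
    case 4
    show ?case
    proof (rule assms(3))
      show "bounded_by S (upd ''halt'' (aval (N 0) \<tau>) (aval (var ''carry'') \<tau>) \<tau>)"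
        using 9(2) by (intro bounded_by_upd) (simp_all add: bounded_byD)
    qed (use 9(3,4) in simp_all)
  qed (use 9(4) plus_2_le_S in simp_all)
qed (use assms(1,2) plus_2_le_S in simp_all)

lemma runs_match_pattern:
  assumes "\<sigma> ''k'' 0 = k" "\<sigma> ''n'' 0 = n"
    and "\<And>\<tau>. bounded_by S \<tau> \<Longrightarrow>
      \<forall>z. z \<notin> {''i'', ''u'', ''b'', ''r'', ''ok'', ''best'', ''w'', ''plan'', ''price'', ''st''} \<longrightarrow> \<tau> z = \<sigma> z \<Longrightarrow>
      \<tau> ''st'' 0 = 1 \<and> (\<forall>i<k. \<tau> ''plan'' i < n \<and> auth i (\<tau> ''plan'' i)) \<and> same_kernel k (\<tau> ''plan'') (\<sigma> ''f'') \<or>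
      \<tau> ''st'' 0 = 2 \<and> \<not> (\<exists>h. (\<forall>i<k. h i < n \<and> auth i (h i)) \<and> same_kernel k h (\<sigma> ''f'')) \<Longrightarrow> Q \<tau>"
  shows "runs match_pattern \<sigma> Q"
proof -
  let ?W = "{''i'', ''u'', ''b'', ''r'', ''ok'', ''best'', ''w'', ''plan'', ''price'', ''st''}"
  let ?matched = "\<lambda>pl. (\<forall>i<k. pl i < n \<and> auth i (pl i)) \<and> same_kernel k pl (\<sigma> ''f'')"
  let ?I = "\<lambda>\<tau>. \<tau> ''st'' 0 = 0 \<and> auction auth n k (\<sigma> ''f'') (\<tau> ''plan'') (\<tau> ''price'') \<or>
    \<tau> ''st'' 0 = 1 \<and> ?matched (\<tau> ''plan'') \<or> \<tau> ''st'' 0 = 2 \<and> \<not> (\<exists>h. ?matched h)"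
  \<comment> \<open>Each bid raises one price that is still below \<open>k\<close>, which lowers the
    potential. The \<open>Suc\<close> in the measure lets the round that sets \<open>''st''\<close>
    decrease it to 0 as well.\<close>
  let ?pot = "\<lambda>p. \<Sum>u<n. k - p u"
  let ?\<mu> = "\<lambda>\<tau>. if \<tau> ''st'' 0 = 0 then Suc (?pot (\<tau> ''price'')) else 0"
  let ?body = "Seq find_task
        (If (Eq (var ''b'') (var ''k'')) (assign ''st'' (N 1))
          (Seq find_user
            (If (Eq (var ''best'') (var ''n'')) (assign ''st'' (N 2)) reassign)))"
  have body: "runs ?body \<tau> (\<lambda>\<tau>'. ?I \<tau>' \<and> ?\<mu> \<tau>' < ?\<mu> \<tau>)"
    if fr: "\<forall>z. z \<notin> ?W \<longrightarrow> \<tau> z = \<sigma> z" and st: "\<tau> ''st'' 0 = 0"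
      and auc: "auction auth n k (\<sigma> ''f'') (\<tau> ''plan'') (\<tau> ''price'')" for \<tau>
  proof (rule runs_Seq, rule runs_find_task, goal_cases)
    case (3 \<rho>)
    have kn: "\<rho> ''k'' 0 = k" "\<rho> ''n'' 0 = n" using 3(2) fr assms(1,2) by simp_all
    have same: "\<rho> ''plan'' = \<tau> ''plan''" "\<rho> ''price'' = \<tau> ''price''" "\<rho> ''st'' = \<tau> ''st''" "\<rho> ''f'' = \<sigma> ''f''"
      using 3(2) fr by simp_all
    show ?case
    proof (rule runs_If, goal_cases)
      case 2
      then have "\<forall>i<k. \<tau> ''plan'' i \<noteq> n" using 3(3) kn by auto
      from auction_complete[OF auc this] show ?case
        using same st S_ge by (intro runs_atoms) simp_all
    next
      case neq: 3
      then have b: "\<rho> ''b'' 0 < k" "\<tau> ''plan'' (\<rho> ''b'' 0) = n" using 3(3) kn by auto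
      show ?case
      proof (rule runs_Seq, rule runs_find_user[of \<rho>, OF kn], goal_cases)
        case (1 \<theta>)
        have kn': "\<theta> ''k'' 0 = k" "\<theta> ''n'' 0 = n" using 1(2) kn by simp_all
        have same': "\<theta> ''plan'' = \<tau> ''plan''" "\<theta> ''price'' = \<tau> ''price''" "\<theta> ''st'' = \<tau> ''st''"
            "\<theta> ''f'' = \<sigma> ''f''" "\<theta> ''b'' = \<rho> ''b''"
          using 1(2) same by simp_all
        let ?al = "allowed auth k (\<sigma> ''f'') (\<rho> ''b'' 0)"
        have ch: "cheapest ?al (\<tau> ''price'') n k n (\<theta> ''best'' 0) (\<theta> ''w'' 0)"
          using 1(3) same by simp
        show ?case
        proof (rule runs_If, goal_cases)
          case 2
          then have "\<forall>u<n. ?al u \<longrightarrow> k \<le> \<tau> ''price'' u" using ch kn' by (auto simp: cheapest_def)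
          then have "\<not> (\<exists>h. ?matched h)" using auction_stuck[OF auc b] by blast
          then show ?case using same' st S_ge by (intro runs_atoms) simp_all
        next
          case 3
          then have u: "\<theta> ''best'' 0 < n" "?al (\<theta> ''best'' 0)" "\<tau> ''price'' (\<theta> ''best'' 0) < k"
              "\<forall>v<n. ?al v \<longrightarrow> \<tau> ''price'' (\<theta> ''best'' 0) \<le> \<tau> ''price'' v"
            using ch kn' by (auto simp: cheapest_def)
          show ?case
          proof (rule runs_reassign[of \<theta>, OF kn' u(1)], goal_cases)
            case (2 \<tau>')
            let ?p = "(\<tau> ''price'')(\<theta> ''best'' 0 := \<tau> ''price'' (\<theta> ''best'' 0) + 1)"
            have pr: "\<tau>' ''price'' = ?p" using 2(4) same' by simp
            have st': "\<tau>' ''st'' 0 = 0" using 2(2) same' st by simp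
            have "auction auth n k (\<sigma> ''f'') (\<tau>' ''plan'') ?p"
              using 2(3) same' by (intro auction_step[OF auc b u]) simp
            moreover have "?pot ?p < ?pot (\<tau> ''price'')"
              using u(1,3) by (intro sum_strict_mono_ex1) auto
            ultimately show ?case using pr st st' by simp
          qed (use u(3) same' in simp)
        qed simp
      qed
    qed simp
  qed (use fr assms(1,2) in simp_all)
  show ?thesis
    unfolding match_pattern_def
  proof (rule runs_Seq, rule runs_For[where l = k and W = "{''plan''}" and
        I = "\<lambda>i \<tau>. \<forall>j<i. \<tau> ''plan'' j = n"], goal_cases)
    case (8 \<tau> i)
    then have "\<tau> ''n'' 0 = n" using assms(2) by simp
    then show ?case using 8(4,5) plus_2_le_S by (intro runs_atoms) (simp_all add: less_Suc_eq)
  next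
    case plan: (9 \<tau>)
    show ?case
    proof (rule runs_Seq, rule runs_For[where l = n and W = "{''price''}" and
          I = "\<lambda>i \<tau>. \<forall>j<i. \<tau> ''price'' j = 0"], goal_cases)
      case (8 \<rho> i)
      then show ?case by (intro runs_atoms) (simp_all add: less_Suc_eq)
    next
      case price: (9 \<rho>)
      let ?\<rho> = "upd ''st'' 0 0 \<rho>"
      have fr: "\<forall>z. z \<notin> ?W \<longrightarrow> ?\<rho> z = \<sigma> z" using plan(2) price(2) by simp
      have pl: "\<rho> ''plan'' = \<tau> ''plan''" using price(2) by simp
      have auc: "auction auth n k (\<sigma> ''f'') (?\<rho> ''plan'') (?\<rho> ''price'')"
        using plan(3) price(3) pl by (intro auction_init) simp_all
      have "?pot (\<rho> ''price'') \<le> (\<Sum>u<n. k)" by (intro sum_mono) simp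
      then have "Suc (?pot (\<rho> ''price'')) \<le> n * k + 1" by simp
      also have "\<dots> \<le> S ^ 2" by (simp add: S_def power2_eq_square algebra_simps)
      finally have pot: "Suc (?pot (\<rho> ''price'')) \<le> S ^ 2" .
      have w: "z \<notin> writes ?body" if "z \<notin> ?W" for z
        using that by (simp add: find_task_def find_user_def check_block_def reassign_def)
      have "runs (While (Eq (var ''st'') (N 0)) ?body) ?\<rho> Q"
      proof (rule runs_While[where I = ?I and \<mu> = ?\<mu>], goal_cases)
        case (4 \<theta>)
        have "\<forall>z. z \<notin> ?W \<longrightarrow> \<theta> z = \<sigma> z"
        proof (intro allI impI)
          fix z assume z: "z \<notin> ?W"
          then have "\<theta> z = ?\<rho> z" using 4(2) w[OF z] by simp
          then show "\<theta> z = \<sigma> z" using fr z by simp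
        qed
        then show ?case using 4(3,4) by (intro body) simp_all
      next
        case (5 \<theta>)
        show ?case
        proof (rule assms(3)[OF 5(1)])
          show "\<forall>z. z \<notin> ?W \<longrightarrow> \<theta> z = \<sigma> z"
          proof (intro allI impI)
            fix z assume z: "z \<notin> ?W"
            then have "\<theta> z = ?\<rho> z" using 5(2) w[OF z] by simp
            then show "\<theta> z = \<sigma> z" using fr z by simp
          qed
        qed (use 5(3,4) in simp)
      qed (use auc pot in simp_all)
      then show ?case by (intro runs_Seq runs_Write) (simp_all add: fun_upd_def)
    qed (use plan(2) assms(2) plus_2_le_S in simp_all)
  qed (use assms(1) plus_2_le_S in simp_all)
qed

section \<open>Exhausting all kernels\<close>

definition good :: "(nat \<Rightarrow> nat) \<Rightarrow> bool" where
  "good a \<longleftrightarrow> (\<forall>i<k. a i < n \<and> auth i (a i)) \<and> (\<forall>c<m. con c a)"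

definition feasible :: "(nat \<Rightarrow> nat) \<Rightarrow> bool" where
  "feasible f \<longleftrightarrow> (\<exists>a. good a \<and> same_kernel k a f)"

text \<open>If any assignment with the kernel of \<open>f\<close> is good, then so is the one that
  the auction happened to find. A failed constraint test on that one therefore refutes the whole
  kernel.\<close>

lemma good_kernel:
  assumes "good a" "\<forall>i<k. a' i < n \<and> auth i (a' i)" "same_kernel k a f" "same_kernel k a' f"
  shows "good a'"
proof -
  have "con c a'" if "c < m" for c
    using assms that by (intro con_kernel[of c a a']) (auto simp: good_def same_kernel_def)
  then show ?thesis using assms(2) by (simp add: good_def)
qed

text \<open>Sending each task to the least task with the same user puts the kernel of an arbitrary
  assignment among the enumerated patterns.\<close>

lemma not_feasible_imp_no_good:
  assumes "\<And>f. \<forall>i<k. f i < k \<Longrightarrow> \<not> feasible f"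
  shows "\<not> good a"
proof
  assume a: "good a"
  define f where "f i = (LEAST j. j < k \<and> a j = a i)" for i
  have f: "f i < k \<and> a (f i) = a i" if "i < k" for i
    unfolding f_def by (rule LeastI[of _ i]) (use that in simp)
  have "same_kernel k a f"
    unfolding same_kernel_def
  proof (intro allI impI iffI)
    fix i j assume "i < k" "j < k"
    then show "a i = a j \<Longrightarrow> f i = f j" "f i = f j \<Longrightarrow> a i = a j"
      using f[of i] f[of j] by (simp add: f_def, metis)
  qed
  then show False using assms[of f] a f by (auto simp: feasible_def)
qed

lemma runs_try_pattern:
  assumes "\<sigma> ''k'' 0 = k" "\<sigma> ''n'' 0 = n" "\<sigma> ''m'' 0 = m" "\<sigma> ''found'' 0 = 0" "\<forall>i<k. \<sigma> ''f'' i < k"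
    and "\<And>\<tau>. bounded_by S \<tau> \<Longrightarrow> \<tau> ''k'' = \<sigma> ''k'' \<and> \<tau> ''n'' = \<sigma> ''n'' \<and> \<tau> ''m'' = \<sigma> ''m'' \<Longrightarrow>
      \<tau> ''halt'' 0 = 1 \<and> \<tau> ''found'' 0 = 1 \<and> good (\<tau> ''plan'') \<or>
      \<tau> ''found'' 0 = 0 \<and> \<not> feasible (\<sigma> ''f'') \<and> (\<forall>i<k. \<tau> ''f'' i < k) \<and> \<tau> ''halt'' 0 \<le> 1 \<and>
      digits_value k (\<tau> ''f'') + \<tau> ''halt'' 0 * k ^ k = digits_value k (\<sigma> ''f'') + 1 \<Longrightarrow> Q \<tau>"
  shows "runs try_pattern \<sigma> Q"
  unfolding try_pattern_def
proof (rule runs_Seq, rule runs_match_pattern[of \<sigma>, OF assms(1,2)], goal_cases)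
  case (1 \<tau>)
  have fr: "\<tau> ''k'' = \<sigma> ''k''" "\<tau> ''n'' = \<sigma> ''n''" "\<tau> ''m'' = \<sigma> ''m''" "\<tau> ''found'' = \<sigma> ''found''" "\<tau> ''f'' = \<sigma> ''f''"
    using 1(2) by simp_all
  have next_pattern: "runs next_pattern \<rho> Q"
    if "\<not> feasible (\<sigma> ''f'')" and fr': "\<forall>z. z \<notin> {''ok'', ''c'', ''r''} \<longrightarrow> \<rho> z = \<tau> z" for \<rho>
  proof (rule runs_next_pattern, goal_cases)
    case (3 \<theta>)
    show ?case
      by (rule assms(6)) (use 3 fr fr' that(1) assms(4) in simp_all)
  qed (use fr fr' assms in simp_all)
  show ?case
  proof (rule runs_If, goal_cases)
    case 2
    then have "\<tau> ''st'' 0 = 1" by simp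
    with 1(3) have m: "\<forall>i<k. \<tau> ''plan'' i < n \<and> auth i (\<tau> ''plan'' i)" "same_kernel k (\<tau> ''plan'') (\<sigma> ''f'')"
      by (simp_all del: One_nat_def)
    show ?case
    proof (rule runs_Seq, rule runs_check_constraints, goal_cases)
      case (2 \<rho>)
      show ?case
      proof (rule runs_If, goal_cases)
        case ok: 2
        then have "\<rho> ''ok'' 0 = 1" by simp
        then have "\<forall>c<m. con c (\<tau> ''plan'')" unfolding 2(3) of_bool_eq_1_iff .
        then have "good (\<tau> ''plan'')" using m(1) by (simp add: good_def)
        moreover have "\<rho> ''plan'' = \<tau> ''plan''" "\<rho> ''k'' = \<sigma> ''k''" "\<rho> ''n'' = \<sigma> ''n''" "\<rho> ''m'' = \<sigma> ''m''"
          using 2(2) fr by simp_all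
        ultimately show ?case using S_pos 2(1)
          by (intro runs_Seq runs_atoms assms(6) bounded_by_upd) simp_all
      next
        case 3
        then have "\<rho> ''ok'' 0 \<noteq> 1" by simp
        then have "\<not> good (\<tau> ''plan'')" unfolding 2(3) of_bool_eq_1_iff good_def by blast
        then have "\<not> feasible (\<sigma> ''f'')" using good_kernel[OF _ m(1) _ m(2)] unfolding feasible_def by blast
        then show ?case using 2(2) by (rule next_pattern)
      qed simp
    qed (use fr assms(3) in simp)
  next
    case 3
    then have "\<tau> ''st'' 0 \<noteq> 1" by simp
    with 1(3) have "\<not> feasible (\<sigma> ''f'')" unfolding feasible_def good_def by blast
    then show ?case by (rule next_pattern) simp
  qed simp
qed

lemma solver_correct:
  "\<exists>t \<tau>. exec oa oc solver (initial n k m) t \<tau> \<and>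
     t \<le> k ^ k * (K + cost try_pattern * S ^ depth try_pattern * K) + K \<and>
     (\<tau> ''found'' 0 = 1 \<and> good (\<tau> ''plan'') \<or> \<tau> ''found'' 0 = 0 \<and> \<not> (\<exists>a. good a))"
proof -
  let ?range = "\<lambda>f. \<forall>i<k. f i < k"
  let ?I = "\<lambda>\<tau> :: state. \<tau> ''k'' 0 = k \<and> \<tau> ''n'' 0 = n \<and> \<tau> ''m'' 0 = m \<and>
    (\<tau> ''halt'' 0 = 0 \<and> \<tau> ''found'' 0 = 0 \<and> ?range (\<tau> ''f'') \<and>
       (\<forall>f. ?range f \<and> digits_value k f < digits_value k (\<tau> ''f'') \<longrightarrow> \<not> feasible f) \<or>
     \<tau> ''halt'' 0 = 1 \<and> (\<tau> ''found'' 0 = 1 \<and> good (\<tau> ''plan'') \<or> \<tau> ''found'' 0 = 0 \<and> \<not> (\<exists>a. good a)))"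
  let ?\<mu> = "\<lambda>\<tau>. if \<tau> ''halt'' 0 = 0 then k ^ k - digits_value k (\<tau> ''f'') else 0"
  have bd: "bounded_by S (initial n k m)"
    by (auto simp: bounded_by_def initial_def upd_def S_def)
  \<comment> \<open>Memory is initially 0: the first pattern is the constant function 0, whose
    numeral 0 has no predecessors to be refuted.\<close>
  have init: "?I (initial n k m)"
    by (auto simp: initial_def digits_value_def)
  have le: "?\<mu> (initial n k m) \<le> k ^ k" by simp
  have "runs try_pattern \<sigma> (\<lambda>\<tau>. ?I \<tau> \<and> ?\<mu> \<tau> < ?\<mu> \<sigma>)"
    if I: "?I \<sigma>" and b: "bval (Eq (var ''halt'') (N 0)) \<sigma>" for \<sigma>
  proof -
    have s: "\<sigma> ''k'' 0 = k" "\<sigma> ''n'' 0 = n" "\<sigma> ''m'' 0 = m" "\<sigma> ''found'' 0 = 0" "?range (\<sigma> ''f'')"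
      and h: "\<sigma> ''halt'' 0 = 0"
      and tried: "\<And>f. ?range f \<Longrightarrow> digits_value k f < digits_value k (\<sigma> ''f'') \<Longrightarrow> \<not> feasible f"
      using I b by auto
    have lt: "digits_value k (\<sigma> ''f'') < k ^ k" by (rule digits_value_less[OF s(5)])
    show ?thesis
    proof (rule runs_try_pattern[of \<sigma>, OF s], goal_cases)
      case (1 \<tau>)
      from 1(3) show ?case
      proof
        assume "\<tau> ''halt'' 0 = 1 \<and> \<tau> ''found'' 0 = 1 \<and> good (\<tau> ''plan'')"
        then show ?thesis using 1(2) s h lt by simp
      next
        assume *: "\<tau> ''found'' 0 = 0 \<and> \<not> feasible (\<sigma> ''f'') \<and> ?range (\<tau> ''f'') \<and> \<tau> ''halt'' 0 \<le> 1 \<and>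
          digits_value k (\<tau> ''f'') + \<tau> ''halt'' 0 * k ^ k = digits_value k (\<sigma> ''f'') + 1"
        have nf: "\<not> feasible f" if f: "?range f" "digits_value k f < digits_value k (\<sigma> ''f'') + 1" for f
        proof (cases "digits_value k f < digits_value k (\<sigma> ''f'')")
          case False
          then have "\<forall>i<k. f i = \<sigma> ''f'' i" using f by (intro digits_value_inj[OF f(1) s(5)]) simp
          then have "feasible f \<longleftrightarrow> feasible (\<sigma> ''f'')" by (simp add: feasible_def same_kernel_def)
          then show ?thesis using * by simp
        qed (use tried f in blast)
        show ?thesis
        proof (cases "\<tau> ''halt'' 0 = 0")
          case True
          then have d: "digits_value k (\<tau> ''f'') = digits_value k (\<sigma> ''f'') + 1" using * by simp
          have "\<forall>f. ?range f \<and> digits_value k f < digits_value k (\<tau> ''f'') \<longrightarrow> \<not> feasible f"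
            unfolding d using nf by blast
          then show ?thesis using 1(2) * True s h lt d by simp
        next
          case False
          then have h1: "\<tau> ''halt'' 0 = 1" using * by linarith
          \<comment> \<open>Overflow means that the current numeral was the largest, so every
            pattern has now been refuted.\<close>
          then have "k ^ k \<le> digits_value k (\<sigma> ''f'') + 1" using * by simp
          then have "\<not> feasible f" if "?range f" for f
            using digits_value_less[OF that] by (intro nf[OF that]) linarith
          then have "\<not> (\<exists>a. good a)" using not_feasible_imp_no_good by blast
          then show ?thesis using 1(2) * h1 s h lt by simp
        qed
      qed
    qed
  qed
  moreover have "bsize (Eq (var ''halt'') (N 0)) \<le> 20" by simp
  ultimately have "\<exists>t \<tau>. exec oa oc solver (initial n k m) t \<tau> \<and>
      t \<le> k ^ k * (K + cost try_pattern * S ^ depth try_pattern * K) + K \<and>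
      bounded_by S \<tau> \<and> ?I \<tau> \<and> \<not> bval (Eq (var ''halt'') (N 0)) \<tau>"
    unfolding solver_def by (intro exec_While[where I = ?I and \<mu> = ?\<mu>, OF _ _ bd init le]) blast+
  then
  obtain t \<tau> where "exec oa oc solver (initial n k m) t \<tau>"
      "t \<le> k ^ k * (K + cost try_pattern * S ^ depth try_pattern * K) + K"
      "?I \<tau>" "\<not> bval (Eq (var ''halt'') (N 0)) \<tau>"
    by blast
  then show ?thesis by (intro exI[of _ t] exI[of _ \<tau>]) auto
qed

end

section \<open>From arrays to plans\<close>

lemma injection_extends_to_permutation:
  assumes "finite U" "X \<subseteq> U" "inj_on g X" "g ` X \<subseteq> U"
  shows "\<exists>\<psi>. \<psi> permutes U \<and> (\<forall>x\<in>X. \<psi> x = g x)"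
proof -
  have fin: "finite X" "finite (g ` X)" using assms finite_subset by blast+
  have "card (U - X) = card (U - g ` X)"
    using assms fin by (simp add: card_Diff_subset card_image)
  then obtain h where h: "bij_betw h (U - X) (U - g ` X)"
    using finite_same_card_bij[of "U - X" "U - g ` X"] assms(1) by auto
  define \<psi> where "\<psi> x = (if x \<in> X then g x else if x \<in> U then h x else x)" for x
  have "bij_betw \<psi> X (g ` X)" using assms(3) by (auto simp: bij_betw_def \<psi>_def inj_on_def)
  moreover have "bij_betw \<psi> (U - X) (U - g ` X)"
    by (rule bij_betw_cong[THEN iffD1, OF _ h]) (simp add: \<psi>_def)
  ultimately have "bij_betw \<psi> (X \<union> (U - X)) (g ` X \<union> (U - g ` X))"
    by (rule bij_betw_combine) auto
  then have "bij_betw \<psi> U U" using assms(2,4) by (simp add: Un_absorb1)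
  then have "\<psi> permutes U" using assms(2) by (intro bij_imp_permutes) (auto simp: \<psi>_def)
  then show ?thesis by (auto simp: \<psi>_def)
qed

lemma decode_eq_Some_iff:
  assumes "distinct ss"
  shows "decode ss us a s = Some u \<longleftrightarrow> (\<exists>i<length ss. a i < length us \<and> s = ss ! i \<and> u = us ! a i)"
proof -
  have "inj_on (\<lambda>i. ss ! i) {0..<length ss}" using assms by (auto simp: inj_on_def nth_eq_iff_index_eq)
  then have "distinct (map (\<lambda>i. ss ! i) (filter (\<lambda>i. a i < length us) [0..<length ss]))"
    by (auto simp: distinct_map inj_on_def)
  then have "distinct (map fst (map (\<lambda>i. (ss ! i, us ! a i)) (filter (\<lambda>i. a i < length us) [0..<length ss])))"
    by (simp add: comp_def)
  then show ?thesis unfolding decode_def by (subst map_of_eq_Some_iff) auto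
qed

lemma decode_nth:
  "distinct ss \<Longrightarrow> i < length ss \<Longrightarrow> a i < length us \<Longrightarrow> decode ss us a (ss ! i) = Some (us ! a i)"
  by (auto simp: decode_eq_Some_iff)

lemma is_plan_decode: "enumerates W ss us cs \<Longrightarrow> is_plan W (decode ss us a)"
  unfolding is_plan_def enumerates_def
  by (auto simp: dom_def ran_def decode_eq_Some_iff)

lemma dom_decode:
  assumes "distinct ss" "\<forall>i<length ss. a i < length us"
  shows "dom (decode ss us a) = set ss"
proof (intro equalityI subsetI)
  fix s assume "s \<in> set ss"
  then obtain i where "i < length ss" "s = ss ! i" by (metis in_set_conv_nth)
  then show "s \<in> dom (decode ss us a)" using decode_nth[OF assms(1)] assms(2) by blast
qed (auto simp: decode_eq_Some_iff[OF assms(1)])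

text \<open>Equal kernels make the passage from the user of a task under \<open>a\<close> to its
  user under \<open>a'\<close> a well-defined injection. A permutation extending it maps one decoded
  plan to the other.\<close>

lemma satisfies_decode_same_kernel:
  assumes W: "wsp_instance W" "enumerates W ss us cs"
    and c: "c \<in> Constraints W" "user_independent (Users W) c"
    and a: "\<forall>i<length ss. a i < length us \<and> a' i < length us"
    and ker: "\<forall>i<length ss. \<forall>j<length ss. a i = a j \<longleftrightarrow> a' i = a' j"
    and sat: "satisfies (decode ss us a) c"
  shows "satisfies (decode ss us a') c"
proof -
  note en = W(2)[unfolded enumerates_def]
  let ?l = "length ss"
  define X where "X = (\<lambda>i. us ! a i) ` {..<?l}"
  have ss: "distinct ss" and us: "distinct us" using en by auto
  have us_eq: "us ! a i = us ! a j \<longleftrightarrow> a i = a j" "us ! a' i = us ! a' j \<longleftrightarrow> a' i = a' j"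
    if "i < ?l" "j < ?l" for i j
    using that a us by (simp_all add: nth_eq_iff_index_eq)
  \<comment> \<open>Any task performed by \<open>x\<close> may be chosen: they form one block, on
    which \<open>a'\<close> is constant.\<close>
  define g where "g x = us ! a' (SOME i. i < ?l \<and> us ! a i = x)" for x
  have g: "g (us ! a i) = us ! a' i" if i: "i < ?l" for i
  proof -
    let ?j = "SOME j. j < ?l \<and> us ! a j = us ! a i"
    have "?j < ?l \<and> us ! a ?j = us ! a i" by (rule someI[of _ i]) (use i in simp)
    then have "a' ?j = a' i" using us_eq(1) ker i by blast
    then show ?thesis by (simp add: g_def)
  qed
  have "\<exists>\<psi>. \<psi> permutes Users W \<and> (\<forall>x\<in>X. \<psi> x = g x)"
  proof (rule injection_extends_to_permutation)
    show "finite (Users W)" using W(1) by (simp add: wsp_instance_def)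
    show "X \<subseteq> Users W" using en a by (auto simp: X_def)
    show "g ` X \<subseteq> Users W" using en a g by (auto simp: X_def)
    show "inj_on g X"
    proof (rule inj_onI)
      fix x y assume "x \<in> X" "y \<in> X" and e: "g x = g y"
      then obtain i j where "i < ?l" "x = us ! a i" "j < ?l" "y = us ! a j" by (auto simp: X_def)
      then show "x = y" using e g us_eq ker by metis
    qed
  qed
  then obtain \<psi> where \<psi>: "\<psi> permutes Users W" "\<And>i. i < ?l \<Longrightarrow> \<psi> (us ! a i) = us ! a' i"
    using g by (auto simp: X_def)
  have dom: "dom (decode ss us a) = Tasks W" "dom (decode ss us a') = Tasks W"
    using dom_decode[OF ss] a en by blast+
  have dec: "decode ss us a' s = map_option \<psi> (decode ss us a s)" for s
  proof (cases "s \<in> Tasks W")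
    case True
    then obtain i where "i < ?l" "s = ss ! i" using en by (metis in_set_conv_nth)
    then show ?thesis using \<psi>(2) a by (simp add: decode_nth[OF ss])
  next
    case False
    then have "decode ss us a s = None" "decode ss us a' s = None" using dom by blast+
    then show ?thesis by simp
  qed
  obtain L \<Theta> where L: "c = (L, \<Theta>)" by fastforce
  then have "L \<subseteq> Tasks W" using W(1) c(1) by (auto simp: wsp_instance_def)
  \<comment> \<open>The decoded plan is complete, so the constraint cannot hold merely because part
    of \<open>L\<close> is unassigned.\<close>
  then have "decode ss us a |` L \<in> \<Theta>" using sat dom by (auto simp: L)
  then have "map_option \<psi> \<circ> (decode ss us a |` L) \<in> \<Theta>" using c(2) \<psi>(1) by (simp add: L)
  moreover have "map_option \<psi> \<circ> (decode ss us a |` L) = decode ss us a' |` L"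
    by (auto simp: fun_eq_iff restrict_map_def dec)
  ultimately show ?thesis by (simp add: L)
qed

lemma valid_complete_decode_iff:
  assumes W: "wsp_instance W" "enumerates W ss us cs" and a: "\<forall>i<length ss. a i < length us"
  shows "complete_plan W (decode ss us a) \<and> valid_plan W (decode ss us a) \<longleftrightarrow>
    (\<forall>i<length ss. us ! a i \<in> Auth W (ss ! i)) \<and> (\<forall>c<length cs. satisfies (decode ss us a) (cs ! c))"
proof -
  note en = W(2)[unfolded enumerates_def]
  have dom: "dom (decode ss us a) = set ss" using dom_decode en a by blast
  have "authorized_plan W (decode ss us a) \<longleftrightarrow> (\<forall>i<length ss. us ! a i \<in> Auth W (ss ! i))"
    unfolding authorized_plan_def dom all_set_conv_all_nth using en a by (simp add: decode_nth)
  moreover have "Constraints W = set cs" using en by simp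
  then have "eligible_plan W (decode ss us a) \<longleftrightarrow> (\<forall>c<length cs. satisfies (decode ss us a) (cs ! c))"
    by (simp add: eligible_plan_def all_set_conv_all_nth)
  moreover have "complete_plan W (decode ss us a)"
    using dom en is_plan_decode[OF W(2)] by (simp add: complete_plan_def)
  ultimately show ?thesis by (auto simp: valid_plan_def)
qed

text \<open>A search over arrays therefore overlooks no complete plan, which is what the negative
  answer relies on.\<close>

lemma complete_plan_is_decode:
  assumes "enumerates W ss us cs" "complete_plan W \<pi>"
  shows "\<exists>a. (\<forall>i<length ss. a i < length us) \<and> decode ss us a = \<pi>"
proof -
  note en = assms(1)[unfolded enumerates_def]
  have "\<exists>j<length us. \<pi> (ss ! i) = Some (us ! j)" if "i < length ss" for i
  proof -
    have "ss ! i \<in> dom \<pi>" using assms(2) en that nth_mem by (fastforce simp: complete_plan_def)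
    then obtain u where u: "\<pi> (ss ! i) = Some u" by blast
    then have "u \<in> set us" using assms(2) en by (auto simp: complete_plan_def is_plan_def ran_def)
    then show ?thesis using u by (metis in_set_conv_nth)
  qed
  then obtain a where a: "\<And>i. i < length ss \<Longrightarrow> a i < length us \<and> \<pi> (ss ! i) = Some (us ! a i)" by metis
  have "decode ss us a s = \<pi> s" for s
  proof (cases "s \<in> set ss")
    case True
    then obtain i where "i < length ss" "s = ss ! i" by (metis in_set_conv_nth)
    then show ?thesis using a en by (simp add: decode_nth)
  next
    case False
    then have "s \<notin> dom (decode ss us a)" "s \<notin> dom \<pi>"
      using dom_decode[of ss a us] a en assms(2) by (auto simp: complete_plan_def)
    then show ?thesis by (auto simp: dom_def)
  qed
  then show ?thesis using a by blast
qed

section \<open>Polynomial bounds in three variables\<close>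

lemma polynomial3_upper_bound:
  assumes "polynomial3 p"
  shows "\<exists>A D. \<forall>n k m. p n k m \<le> real (A * (n + k + m + 2) ^ D)"
proof -
  obtain d c where p: "\<And>n k m. p n k m =
      (\<Sum>i\<le>d. \<Sum>j\<le>d. \<Sum>l\<le>(d::nat). c i j l * real n ^ i * real k ^ j * real m ^ l)"
    using assms unfolding polynomial3_def by blast
  let ?A = "\<Sum>i\<le>d. \<Sum>j\<le>d. \<Sum>l\<le>d. \<bar>c i j l\<bar>"
  \<comment> \<open>Coefficients may be negative, hence the absolute values. Each variable is at
    most the base and occurs with exponent at most \<open>d\<close>, which gives the exponent
    \<open>d + d + d\<close>.\<close>
  have "p n k m \<le> real (nat \<lceil>?A\<rceil> * (n + k + m + 2) ^ (d + d + d))" for n k m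
  proof -
    let ?s = "real n + real k + real m + 2"
    have "c i j l * real n ^ i * real k ^ j * real m ^ l \<le> \<bar>c i j l\<bar> * ?s ^ (d + d + d)"
      if "i \<le> d" "j \<le> d" "l \<le> d" for i j l
    proof -
      have pw: "x ^ e \<le> ?s ^ d" if "0 \<le> x" "x \<le> ?s" "e \<le> d" for x e
        using power_mono[OF that(2,1), of e] power_increasing[OF that(3), of ?s] by linarith
      have "real n ^ i * real k ^ j * real m ^ l \<le> ?s ^ d * ?s ^ d * ?s ^ d"
        using that by (intro mult_mono pw) auto
      then have "\<bar>c i j l\<bar> * (real n ^ i * real k ^ j * real m ^ l) \<le> \<bar>c i j l\<bar> * ?s ^ (d + d + d)"
        by (intro mult_left_mono) (simp_all add: power_add)
      moreover have "c i j l * (real n ^ i * real k ^ j * real m ^ l) \<le>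
          \<bar>c i j l\<bar> * (real n ^ i * real k ^ j * real m ^ l)"
        by (intro mult_right_mono) auto
      ultimately show ?thesis by (simp add: mult.assoc)
    qed
    then have "p n k m \<le> (\<Sum>i\<le>d. \<Sum>j\<le>d. \<Sum>l\<le>d. \<bar>c i j l\<bar> * ?s ^ (d + d + d))"
      unfolding p by (intro sum_mono) auto
    also have "\<dots> = ?A * ?s ^ (d + d + d)" by (simp only: sum_distrib_right)
    also have "\<dots> \<le> real (nat \<lceil>?A\<rceil>) * ?s ^ (d + d + d)"
      by (intro mult_right_mono) (auto simp: real_nat_ceiling_ge)
    finally show ?thesis by (simp add: add.commute add.left_commute)
  qed
  then show ?thesis by blast
qed

lemma power_Suc_le_sum_powers: "(real x + 1) ^ D \<le> 2 ^ D * (\<Sum>i\<le>D. real x ^ i)"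
proof -
  have "(real x + 1) ^ D = (\<Sum>i\<le>D. real (D choose i) * real x ^ i)"
    by (simp add: binomial_ring)
  also have "\<dots> \<le> (\<Sum>i\<le>D. 2 ^ D * real x ^ i)"
  proof (intro sum_mono mult_right_mono)
    fix i
    have "D choose i \<le> 2 ^ D" by (rule binomial_le_pow2)
    then have "real (D choose i) \<le> real (2 ^ D)" by (rule of_nat_mono)
    then show "real (D choose i) \<le> 2 ^ D" by simp
  qed simp
  finally show ?thesis by (simp add: sum_distrib_left)
qed

text \<open>\<open>polynomial3\<close> asks for explicit coefficients. Bounding the sum by
  \<open>2 * (n + 1) * (k + 1) * (m + 1)\<close> separates the variables, so the binomial theorem in
  one variable replaces a multinomial expansion, and \<open>q\<close> can have all coefficients
  1.\<close>

lemma power_le_polynomial3: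
  "\<exists>q C. polynomial3 q \<and> (\<forall>n k m. real ((n + k + m + 2) ^ D) \<le> C * q n k m)"
proof -
  define q where "q n k m = (\<Sum>i\<le>D. \<Sum>j\<le>D. \<Sum>l\<le>D. real n ^ i * real k ^ j * real m ^ l)" for n k m :: nat
  have "polynomial3 q"
    unfolding polynomial3_def q_def by (intro exI[of _ D] exI[of _ "\<lambda>_ _ _. 1"]) simp
  moreover have "real ((n + k + m + 2) ^ D) \<le> (2 ^ D * 2 ^ D * 2 ^ D * 2 ^ D) * q n k m" for n k m
  proof -
    let ?f = "\<lambda>x :: nat. \<Sum>i\<le>D. real x ^ i"
    have "n + k + m + 2 \<le> 2 * (n + 1) * (k + 1) * (m + 1)" by (simp add: algebra_simps)
    then have "(n + k + m + 2) ^ D \<le> (2 * (n + 1) * (k + 1) * (m + 1)) ^ D" by (rule power_mono) simp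
    then have "real ((n + k + m + 2) ^ D) \<le> real ((2 * (n + 1) * (k + 1) * (m + 1)) ^ D)"
      by (rule of_nat_mono)
    also have "\<dots> = 2 ^ D * (real n + 1) ^ D * (real k + 1) ^ D * (real m + 1) ^ D"
      by (simp only: of_nat_power of_nat_mult of_nat_add of_nat_1 of_nat_numeral power_mult_distrib)
    also have "\<dots> \<le> 2 ^ D * (2 ^ D * ?f n) * (2 ^ D * ?f k) * (2 ^ D * ?f m)"
      by (intro mult_mono power_Suc_le_sum_powers order_refl) (auto intro!: mult_nonneg_nonneg sum_nonneg)
    also have "\<dots> = (2 ^ D * 2 ^ D * 2 ^ D * 2 ^ D) * (?f n * (?f k * ?f m))"
      by (simp only: mult_ac)
    also have "?f n * (?f k * ?f m) = (\<Sum>i\<le>D. real n ^ i * (\<Sum>j\<le>D. real k ^ j * ?f m))"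
      by (simp only: sum_distrib_right)
    also have "\<dots> = q n k m" by (simp only: q_def sum_distrib_left mult.assoc)
    finally show ?thesis .
  qed
  ultimately show ?thesis by (intro exI[of _ q] exI[of _ "2 ^ D * 2 ^ D * 2 ^ D * 2 ^ D"]) auto
qed

text \<open>At \<open>k = 0\<close> both sides are 1: the exponent on the left vanishes through its
  factor \<open>real k\<close>, and \<open>0 ^ 0 = 1\<close>.\<close>

lemma powr_mult_log: "2 powr (real k * log 2 (real k)) = real (k ^ k)"
proof (cases "k = 0")
  case False
  then have "2 powr (real k * log 2 (real k)) = (2 powr log 2 (real k)) powr real k"
    by (simp only: powr_powr mult.commute)
  also have "\<dots> = real k ^ k" using False by (simp add: powr_realpow)
  finally show ?thesis by simp
qed simp

lemma solver_solves:
  assumes W: "wsp_instance W" "\<forall>c\<in>Constraints W. user_independent (Users W) c"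
      "enumerates W ss us cs" "checks_within p W ta tc"
    and nkm: "n = card (Users W)" "k = card (Tasks W)" "m = card (Constraints W)"
    and p: "p n k m \<le> real (A * (n + k + m + 2) ^ D)"
  shows "\<exists>t \<tau>. exec (auth_check W ta ss us) (con_check tc ss us cs) solver (initial n k m) t \<tau> \<and>
    solution W ss us \<tau> \<and>
    t \<le> (cost try_pattern + 2) * (A + 1000) * (n + k + m + 2) ^ (depth try_pattern + D + 1) * k ^ k"
proof -
  note en = W(3)[unfolded enumerates_def]
  have len: "length us = n" "length ss = k" "length cs = m"
    using en nkm distinct_card by metis+
  have ta: "real (ta s u) \<le> p n k m" if "s \<in> Tasks W" "u \<in> Users W" for s u
    using W(4) that nkm by (auto simp: checks_within_def Let_def)
  have tc: "real (tc c \<pi>) \<le> p n k m" if "c \<in> Constraints W" "is_plan W \<pi>" for c \<pi>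
    using W(4) that nkm by (auto simp: checks_within_def Let_def)
  define R where "R = A * (n + k + m + 2) ^ D"
  define auth where "auth i u \<longleftrightarrow> us ! u \<in> Auth W (ss ! i)" for i u
  define con where "con c a \<longleftrightarrow> satisfies (decode ss us a) (cs ! c)" for c a
  interpret wsp_machine "auth_check W ta ss us" "con_check tc ss us cs" n k m R auth con
  proof
    fix i u assume "i < k" "u < n"
    moreover from this have "real (ta (ss ! i) (us ! u)) \<le> real R"
      using ta[of "ss ! i" "us ! u"] p en len by (metis R_def nth_mem order_trans)
    ultimately show "\<exists>t\<le>R. auth_check W ta ss us i u = Some (auth i u, t)"
      using len by (simp add: auth_check_def auth_def)
  next
    fix c a assume "c < m"
    moreover from this have "real (tc (cs ! c) (decode ss us a)) \<le> real R"
      using tc[of "cs ! c"] is_plan_decode[OF W(3)] p en len by (metis R_def nth_mem order_trans)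
    ultimately show "\<exists>t\<le>R. con_check tc ss us cs c a = Some (con c a, t)"
      using len by (simp add: con_check_def con_def)
  next
    fix c a a' assume c: "c < m" and *: "\<forall>i<k. a i < n \<and> a' i < n"
      "\<forall>i<k. \<forall>j<k. (a i = a j) = (a' i = a' j)" "con c a"
    have "cs ! c \<in> Constraints W" using c en len nth_mem by blast
    then show "con c a'"
      using satisfies_decode_same_kernel[OF W(1,3), of "cs ! c" a a'] W(2) * len by (simp add: con_def)
  qed
  have good: "good a \<longleftrightarrow> (\<forall>i<k. a i < n) \<and> complete_plan W (decode ss us a) \<and> valid_plan W (decode ss us a)" for a
    using valid_complete_decode_iff[OF W(1,3), of a] len by (auto simp: good_def auth_def con_def)
  obtain t \<tau> where 1: "exec (auth_check W ta ss us) (con_check tc ss us cs) solver (initial n k m) t \<tau>"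
      "t \<le> k ^ k * (K + cost try_pattern * S ^ depth try_pattern * K) + K"
      "\<tau> ''found'' 0 = 1 \<and> good (\<tau> ''plan'') \<or> \<tau> ''found'' 0 = 0 \<and> \<not> (\<exists>a. good a)"
    using solver_correct by blast
  have "(\<exists>\<pi>. complete_plan W \<pi> \<and> valid_plan W \<pi>) \<longleftrightarrow> (\<exists>a. good a)"
    using complete_plan_is_decode[OF W(3)] good len by metis
  then have "solution W ss us \<tau>"
    using 1(3) good unfolding solution_def by auto
  moreover have "t \<le> (cost try_pattern + 2) * (A + 1000) * S ^ (depth try_pattern + D + 1) * k ^ k"
  proof -
    let ?c = "cost try_pattern" and ?e = "depth try_pattern"
    \<comment> \<open>This holds for \<open>k = 0\<close> too, and lets the factor
      \<open>k ^ k\<close> absorb the last, failing test of the outermost loop.\<close>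
    have kk: "1 \<le> k ^ k" by (cases "k = 0") auto
    have Se: "1 \<le> S ^ ?e" using S_pos by simp
    have "R = A * S ^ D" by (simp add: R_def S_def)
    also have "\<dots> \<le> A * S ^ (D + 1)" using S_pos by (intro mult_le_mono2 power_increasing) auto
    finally have "R \<le> A * S ^ (D + 1)" .
    moreover have "S ^ 1 \<le> S ^ (D + 1)" using S_pos by (intro power_increasing) auto
    ultimately have K: "K \<le> (A + 1000) * S ^ (D + 1)"
      unfolding K_def add_mult_distrib power_one_right by linarith
    have "K \<le> S ^ ?e * K" using Se by simp
    moreover have "(?c + 2) * S ^ ?e * K = S ^ ?e * K + ?c * S ^ ?e * K + S ^ ?e * K"
      by (simp add: algebra_simps)
    ultimately have "(K + ?c * S ^ ?e * K) + K \<le> (?c + 2) * S ^ ?e * K" by linarith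
    then have "k ^ k * ((K + ?c * S ^ ?e * K) + K) \<le> k ^ k * ((?c + 2) * S ^ ?e * K)"
      by (rule mult_le_mono2)
    moreover have "1 * K \<le> k ^ k * K" using kk by (rule mult_le_mono1)
    ultimately have "t \<le> k ^ k * ((?c + 2) * S ^ ?e * K)"
      using 1(2) unfolding distrib_left by linarith
    also have "\<dots> \<le> k ^ k * ((?c + 2) * S ^ ?e * ((A + 1000) * S ^ (D + 1)))"
      using K by (intro mult_le_mono2)
    also have "\<dots> = (?c + 2) * (A + 1000) * S ^ (?e + D + 1) * k ^ k"
      by (simp only: power_add mult_ac)
    finally show ?thesis .
  qed
  ultimately show ?thesis using 1(1) unfolding S_def by blast
qed

theorem theorem17:
  fixes p :: "nat \<Rightarrow> nat \<Rightarrow> nat \<Rightarrow> real"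
  assumes "polynomial3 p"
  shows "\<exists>P. solves_in_O_star p P
           (\<lambda>W :: ('s, 'u) wsp. \<forall>c\<in>Constraints W. user_independent (Users W) c)
           (\<lambda>k. 2 powr (real k * log 2 (real k)))"
proof -
  obtain A D where p: "\<And>n k m. p n k m \<le> real (A * (n + k + m + 2) ^ D)"
    using polynomial3_upper_bound[OF assms] by blast
  \<comment> \<open>\<open>A\<close>, \<open>D\<close>, and with them \<open>E\<close>,
    \<open>B\<close>, \<open>q\<close> and \<open>C\<close>, are fixed before any instance, as the
    order of quantifiers in \<open>solves_in_O_star\<close> demands.\<close>
  define E where "E = depth try_pattern + D + 1"
  define B where "B = (cost try_pattern + 2) * (A + 1000)"
  obtain q C where q: "polynomial3 q" "\<And>n k m. real ((n + k + m + 2) ^ E) \<le> C * q n k m"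
    using power_le_polynomial3[of E] by blast
  have time: "real t \<le> (real B * C) * (q n k m * real (k ^ k))"
    if "t \<le> B * (n + k + m + 2) ^ E * k ^ k" for t n k m
  proof -
    have "real t \<le> real (B * (n + k + m + 2) ^ E * k ^ k)" using that by (rule of_nat_mono)
    also have "\<dots> = real B * real ((n + k + m + 2) ^ E) * real (k ^ k)" by simp
    also have "\<dots> \<le> real B * (C * q n k m) * real (k ^ k)"
      by (intro mult_right_mono mult_left_mono q(2)) auto
    finally show ?thesis by (simp only: mult_ac)
  qed
  have "solves_in_O_star p solver
      (\<lambda>W :: ('s, 'u) wsp. \<forall>c\<in>Constraints W. user_independent (Users W) c)
      (\<lambda>k. 2 powr (real k * log 2 (real k)))"
    unfolding solves_in_O_star_def powr_mult_log
  proof (intro exI[of _ q] exI[of _ "real B * C"] conjI q(1) allI impI, elim conjE)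
    fix W :: "('s, 'u) wsp" and ss us cs ta tc n k m
    assume "wsp_instance W" "\<forall>c\<in>Constraints W. user_independent (Users W) c"
      "enumerates W ss us cs" "checks_within p W ta tc"
      "n = card (Users W)" "k = card (Tasks W)" "m = card (Constraints W)"
    from solver_solves[OF this p] show "\<exists>t \<tau>.
        exec (auth_check W ta ss us) (con_check tc ss us cs) solver (initial n k m) t \<tau> \<and>
        solution W ss us \<tau> \<and> real t \<le> real B * C * (q n k m * real (k ^ k))"
      unfolding E_def[symmetric] B_def[symmetric] using time by blast
  qed
  then show ?thesis ..
qed

end
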